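(* Let $\mathbb{F}$ be a field of characteristic not two and let $A$ be an axial algebra of Jordan type half over $\mathbb{F}$ generated by primitive axes $a$, $b$, $c$. Put $\alpha=\varphi_a(b)$, $\beta=\varphi_b(c)$, $\gamma=\varphi_c(a)$, $\psi=\varphi_a(bc)$. If $A$ is 9-dimensional, then the following hold. (i) If $(\alpha+\beta+\gamma-2\psi-1)(\alpha\beta\gamma-\psi^2)\neq 0$ and $\psi^2-\alpha\beta\gamma$ is a square in $\mathbb{F}$, then $A$ is isomorphic to $M_3(\mathbb{F})^+$. (ii) If $(\alpha+\beta+\gamma-2\psi-1)(\alpha\beta\gamma-\psi^2)\neq 0$ and $\psi^2-\alpha\beta\gamma$ is not a square in $\mathbb{F}$, let $\mathbb{P}=\mathbb{F}(z)$, where $z^2=\psi^2-\alpha\beta\gamma$, and let the bar denote the involution of $\mathbb{P}$ given by $x+zy\mapsto x-zy$ for $x,y\in\mathbb{F}$. Then $A$ is isomorphic (as an $\mathbb{F}$-algebra) to $H(M_3(\mathbb{P}),j)$, where $j$ is the involution given by $X^j=T^{-1}\overline{X}'T$ for some (invertible) $T\in M_3(\mathbb{P})$ such that $T^j=tT$ with $t\in\mathbb{P}$ and $t\overline{t}=1$. (iii) If $(\alpha+\beta+\gamma-2\psi-1)(\alpha\beta\gamma-\psi^2)=0$, then $A$ is not simple.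
   Context: Algebras are not assumed associative. For a commutative $\mathbb{F}$-algebra $A$, $a\in A$ and $\lambda\in\mathbb{F}$, let $ad_a: x\mapsto xa$ and let $A_\lambda(a)$ be the $\lambda$-eigenspace of $ad_a$ (possibly zero). A commutative $\mathbb{F}$-algebra $A$ is an axial algebra of Jordan type half if, with $\eta=\frac12$, it is generated (as an algebra) by a set $X$ of idempotents (called axes) such that for each $a\in X$: (1) the minimal polynomial of $ad_a$ divides $(x-1)x(x-\eta)$, so $A=A_1(a)\oplus A_0(a)\oplus A_\eta(a)$; (2) $A_1(a)A_1(a)\subseteq A_1(a)$, $A_0(a)A_0(a)\subseteq A_0(a)$, $A_1(a)A_0(a)=\{0\}$, $(A_0(a)+A_1(a))A_\eta(a)\subseteq A_\eta(a)$, $A_\eta(a)A_\eta(a)\subseteq A_0(a)+A_1(a)$. An axis $a$ is primitive if $A_1(a)=\langle a\rangle$ is 1-dimensional. "Generated by primitive axes $a,b,c$" means one may take $X=\{a,b,c\}$ with all three axes primitive. For a primitive axis $a$ and $y\in A$, $\varphi_a(y)\in\mathbb{F}$ is the scalar such that the projection of $y$ on $A_1(a)$ along $A_0(a)\oplus A_{1/2}(a)$ equals $\varphi_a(y)a$. $M_n(\mathbb{F})^+$ is the algebra of $n\times n$ matrices with the Jordan product $X\circ Y=\frac12(XY+YX)$. An involution of an associative $\mathbb{F}$-algebra $R$ is an $\mathbb{F}$-linear map $j:R\to R$ with $(xy)^j=y^jx^j$ and $(x^j)^j=x$; $H(R,j)$ is the $\mathbb{F}$-algebra of all $x\in R$ with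 $x^j=x$, with the product $x\circ y=\frac12(xy+yx)$. In (ii), $M_3(\mathbb{P})$ is regarded as an $\mathbb{F}$-algebra, $X'$ is the transpose of $X$, and $\overline{X}$ is obtained by applying the bar to each entry. An algebra is simple if it contains no non-trivial ideals and its multiplication is not zero. *)

theory Defs
  imports
    "HOL-Analysis.Analysis"
    "HOL-Computational_Algebra.Computational_Algebra"
begin

locale comm_nonassoc_algebra =
  vector_space scale for scale :: "'f::field \<Rightarrow> 'a::ab_group_add \<Rightarrow> 'a" +
  fixes mult :: "'a \<Rightarrow> 'a \<Rightarrow> 'a"
  assumes mult_comm: "mult x y = mult y x"
    and mult_add_left: "mult (x + y) w = mult x w + mult y w"
    and mult_scale_left: "mult (scale k x) y = scale k (mult x y)"
begin

definition set_mult :: "'a set \<Rightarrow> 'a set \<Rightarrow> 'a set" where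
  "set_mult U V = {mult u v | u v. u \<in> U \<and> v \<in> V}"

definition subalgebra :: "'a set \<Rightarrow> bool" where
  "subalgebra S \<longleftrightarrow> subspace S \<and> set_mult S S \<subseteq> S"

definition generated_by :: "'a set \<Rightarrow> bool" where
  "generated_by X \<longleftrightarrow> \<Inter>{S. subalgebra S \<and> X \<subseteq> S} = UNIV"

definition algebra_ideal :: "'a set \<Rightarrow> bool" where
  "algebra_ideal I \<longleftrightarrow> subspace I \<and> set_mult I UNIV \<subseteq> I"

definition simple_algebra :: "bool" where
  "simple_algebra \<longleftrightarrow>
     (\<forall>I. algebra_ideal I \<longrightarrow> I = {0} \<or> I = UNIV) \<and> (\<exists>x y. mult x y \<noteq> 0)"

definition ad :: "'a \<Rightarrow> 'a \<Rightarrow> 'a" where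
  "ad a = (\<lambda>x. mult x a)"

definition eigenspace :: "'f \<Rightarrow> 'a \<Rightarrow> 'a set" where
  "eigenspace l a = {x. ad a x = scale l x}"

definition poly_at_operator :: "'f poly \<Rightarrow> ('a \<Rightarrow> 'a) \<Rightarrow> 'a \<Rightarrow> 'a" where
  "poly_at_operator p T = (\<lambda>x. \<Sum>i\<le>degree p. scale (coeff p i) ((T ^^ i) x))"

definition minimal_polynomial :: "('a \<Rightarrow> 'a) \<Rightarrow> 'f poly \<Rightarrow> bool" where
  "minimal_polynomial T m \<longleftrightarrow>
     lead_coeff m = 1 \<and> poly_at_operator m T = (\<lambda>x. 0) \<and>
     (\<forall>q. q \<noteq> 0 \<and> poly_at_operator q T = (\<lambda>x. 0) \<longrightarrow> degree m \<le> degree q)"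

text \<open>Sums of eigenspaces below are elementwise sums of sets.\<close>

definition jordan_type_axis :: "'f \<Rightarrow> 'a \<Rightarrow> bool" where
  "jordan_type_axis \<eta> a \<longleftrightarrow>
     mult a a = a \<and>
     (\<exists>m. minimal_polynomial (ad a) m \<and> m dvd [:-1, 1:] * [:0, 1:] * [:-\<eta>, 1:]) \<and>
     set_mult (eigenspace 1 a) (eigenspace 1 a) \<subseteq> eigenspace 1 a \<and>
     set_mult (eigenspace 0 a) (eigenspace 0 a) \<subseteq> eigenspace 0 a \<and>
     set_mult (eigenspace 1 a) (eigenspace 0 a) = {0} \<and>
     set_mult (eigenspace 0 a + eigenspace 1 a) (eigenspace \<eta> a) \<subseteq> eigenspace \<eta> a \<and>
     set_mult (eigenspace \<eta> a) (eigenspace \<eta> a) \<subseteq> eigenspace 0 a + eigenspace 1 a"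

definition primitive :: "'a \<Rightarrow> bool" where
  "primitive a \<longleftrightarrow> eigenspace 1 a = span {a} \<and> dim (eigenspace 1 a) = 1"

definition jordan_type_half_generated_by :: "'a set \<Rightarrow> bool" where
  "jordan_type_half_generated_by X \<longleftrightarrow>
     generated_by X \<and> (\<forall>a\<in>X. jordan_type_axis (1/2) a)"

text \<open>Meaningful for primitive axes of Jordan type half, where the scalar exists and is unique.\<close>

definition phi :: "'a \<Rightarrow> 'a \<Rightarrow> 'f" where
  "phi a y = (THE r. \<exists>u \<in> eigenspace 0 a. \<exists>v \<in> eigenspace (1/2) a. y = scale r a + u + v)"

end

text \<open>
  An algebra is given by a carrier set, its scalar action and its product; addition is that of
  the ambient type.
\<close>

definition algebra_isomorphic ::
    "'a::ab_group_add set \<Rightarrow> ('f \<Rightarrow> 'a \<Rightarrow> 'a) \<Rightarrow> ('a \<Rightarrow> 'a \<Rightarrow> 'a) \<Rightarrow>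
     'b::ab_group_add set \<Rightarrow> ('f \<Rightarrow> 'b \<Rightarrow> 'b) \<Rightarrow> ('b \<Rightarrow> 'b \<Rightarrow> 'b) \<Rightarrow> bool" where
  "algebra_isomorphic A sA mA B sB mB \<longleftrightarrow>
     (\<exists>h. bij_betw h A B \<and>
          (\<forall>x\<in>A. \<forall>y\<in>A. h (x + y) = h x + h y) \<and>
          (\<forall>k. \<forall>x\<in>A. h (sA k x) = sB k (h x)) \<and>
          (\<forall>x\<in>A. \<forall>y\<in>A. h (mA x y) = mB (h x) (h y)))"

definition is_involution ::
    "'b::ab_group_add set \<Rightarrow> ('f \<Rightarrow> 'b \<Rightarrow> 'b) \<Rightarrow> ('b \<Rightarrow> 'b \<Rightarrow> 'b) \<Rightarrow> ('b \<Rightarrow> 'b) \<Rightarrow> bool" where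
  "is_involution R s m j \<longleftrightarrow>
     (\<forall>x\<in>R. j x \<in> R) \<and>
     (\<forall>x\<in>R. \<forall>y\<in>R. j (x + y) = j x + j y) \<and>
     (\<forall>k. \<forall>x\<in>R. j (s k x) = s k (j x)) \<and>
     (\<forall>x\<in>R. \<forall>y\<in>R. j (m x y) = m (j y) (j x)) \<and>
     (\<forall>x\<in>R. j (j x) = x)"

definition hermitian_elements :: "'b set \<Rightarrow> ('b \<Rightarrow> 'b) \<Rightarrow> 'b set" where
  "hermitian_elements R j = {x \<in> R. j x = x}"

definition mat_smult :: "'k::times \<Rightarrow> 'k^'n^'m \<Rightarrow> 'k^'n^'m" where
  "mat_smult k X = map_matrix (\<lambda>x. k * x) X"

definition jordan_product :: "'k::field^'n^'n \<Rightarrow> 'k^'n^'n \<Rightarrow> 'k^'n^'n" where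
  "jordan_product X Y = mat_smult (1/2) (X ** Y + Y ** X)"

definition matrices_over :: "'k set \<Rightarrow> ('k^'n^'m) set" where
  "matrices_over P = {X. \<forall>i j. X $ i $ j \<in> P}"

text \<open>
  The extension of \<open>F\<close> by \<open>z\<close> is taken inside an arbitrary field \<open>'k\<close> into which
  \<open>F\<close> is embedded, since a type cannot depend on the element whose root is adjoined.
\<close>

definition field_embedding :: "('f::field \<Rightarrow> 'k::field) \<Rightarrow> bool" where
  "field_embedding emb \<longleftrightarrow>
     emb 1 = 1 \<and> (\<forall>x y. emb (x + y) = emb x + emb y) \<and> (\<forall>x y. emb (x * y) = emb x * emb y)"

definition is_subfield :: "'k::field set \<Rightarrow> bool" where
  "is_subfield S \<longleftrightarrow>
     0 \<in> S \<and> 1 \<in> S \<and> (\<forall>x\<in>S. \<forall>y\<in>S. x - y \<in> S \<and> x * y \<in> S) \<and> (\<forall>x\<in>S. inverse x \<in> S)"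

definition adjoin :: "('f::field \<Rightarrow> 'k::field) \<Rightarrow> 'k \<Rightarrow> 'k set" where
  "adjoin emb z = \<Inter>{S. is_subfield S \<and> range emb \<subseteq> S \<and> z \<in> S}"

text \<open>Meaningful on \<open>adjoin emb z\<close> when \<open>z\<close> is quadratic over, and not in, the image of \<open>emb\<close>.\<close>

definition conj_ext :: "('f::field \<Rightarrow> 'k::field) \<Rightarrow> 'k \<Rightarrow> 'k \<Rightarrow> 'k" where
  "conj_ext emb z p = (THE q. \<exists>x y. p = emb x + z * emb y \<and> q = emb x - z * emb y)"

definition twisted_conj_transpose ::
    "('f::field \<Rightarrow> 'k::field) \<Rightarrow> 'k \<Rightarrow> 'k^'n^'n \<Rightarrow> 'k^'n^'n \<Rightarrow> 'k^'n^'n" where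
  "twisted_conj_transpose emb z T X =
     matrix_inv T ** transpose (map_matrix (conj_ext emb z) X) ** T"

end

theory Submission
  imports Defs
begin

text \<open>
  Write \<open>x \<circ> y = 2 x y\<close> (called \<open>jp\<close> below). The fusion rules of a primitive axis \<open>e\<close> give identities for
  \<open>(e \<circ> x) \<circ> (e \<circ> y)\<close> and \<open>e \<circ> (x \<circ> (e \<circ> y))\<close>, the second of which determines every product
  \<open>x \<circ> (e \<circ> y)\<close> from simpler ones. Hence all products of the nine elements
  \<open>a, b, c, b \<circ> c, c \<circ> a, a \<circ> b, {b a c}, {c b a}, {a c b}\<close> are combinations of these elements, with coefficients
  polynomial in \<open>\<alpha>, \<beta>, \<gamma>\<close> and \<open>s = 2 \<psi>\<close>; in dimension nine they form a basis. The same table is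
  satisfied by rank one idempotent matrices with Gram matrix
  \<open>G = ((1, 1, k), (\<alpha>, 1, 1), (p, \<beta>, 1))\<close>, where \<open>p\<close> and \<open>\<alpha> \<beta> k\<close> are the roots of
  \<open>X\<^sup>2 - s X + \<alpha> \<beta> \<gamma>\<close>. This representation is faithful and spans all \<open>3 \<times> 3\<close> matrices over the field of the roots
  when \<open>det G = 1 - \<alpha> - \<beta> - \<gamma> + s\<close> and the discriminant are nonzero; over a proper quadratic
  extension the axes are hermitian for a form obtained by scaling the rows of \<open>G\<close>.
  If \<open>det G = 0\<close>, the adjugate of \<open>G\<close> yields an element annihilating the algebra; if the discriminant
  vanishes, explicit linear conditions define a proper nonzero ideal.
\<close>

unbundle no fps_syntax

section \<open>Primitive axes of Jordan type half\<close>

context comm_nonassoc_algebra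
begin

section \<open>Polynomials in a linear operator\<close>

lemma poly_at_operator_altdef:
  assumes "degree p \<le> n"
  shows "poly_at_operator p T x = (\<Sum>i\<le>n. scale (coeff p i) ((T ^^ i) x))"
  unfolding poly_at_operator_def
  by (rule sum.mono_neutral_left) (use assms in \<open>auto simp: coeff_eq_0\<close>)

lemma poly_at_operator_0: "poly_at_operator 0 T x = 0"
  by (simp add: poly_at_operator_def)

lemma poly_at_operator_add:
  "poly_at_operator (p + q) T x = poly_at_operator p T x + poly_at_operator q T x"
proof -
  let ?n = "max (degree p) (degree q)"
  have "degree (p + q) \<le> ?n" by (rule degree_add_le_max)
  then show ?thesis
    by (subst (1 2 3) poly_at_operator_altdef[where n = ?n])
      (simp_all add: scale_left_distrib sum.distrib)
qed

lemma poly_at_operator_smult: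
  "poly_at_operator (smult k p) T x = scale k (poly_at_operator p T x)"
  by (subst (1 2) poly_at_operator_altdef[where n = "degree p"])
    (simp_all add: scale_sum_right)

lemma poly_at_operator_pCons:
  assumes "\<And>x y. T (x + y) = T x + T y" "\<And>k x. T (scale k x) = scale k (T x)"
  shows "poly_at_operator (pCons k p) T x = scale k x + T (poly_at_operator p T x)"
proof -
  have T0: "T 0 = 0" using assms(2)[of 0 0] by simp
  have sum: "T (sum g S) = (\<Sum>i\<in>S. T (g i))" if "finite S" for g :: "nat \<Rightarrow> 'a" and S
    using that by (induction S rule: finite_induct) (auto simp: T0 assms)
  have "poly_at_operator (pCons k p) T x =
      (\<Sum>i\<le>Suc (degree p). scale (coeff (pCons k p) i) ((T ^^ i) x))"
    by (rule poly_at_operator_altdef) (rule degree_pCons_le)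
  also have "\<dots> = scale k x + (\<Sum>i\<le>degree p. scale (coeff p i) ((T ^^ Suc i) x))"
    by (subst sum.atMost_Suc_shift) simp
  also have "\<dots> = scale k x + T (poly_at_operator p T x)"
    by (simp add: poly_at_operator_def sum assms)
  finally show ?thesis .
qed

text \<open>The polynomials annihilating \<open>T\<close> form an ideal, by induction on the
  cofactor of \<open>m\<close>. This turns the condition on the minimal polynomial of
  \<open>ad a\<close> into a cubic identity.\<close>

lemma poly_at_operator_dvd:
  assumes lin: "\<And>x y. T (x + y) = T x + T y" "\<And>k x. T (scale k x) = scale k (T x)"
    and "m dvd p" "poly_at_operator m T = (\<lambda>x. 0)"
  shows "poly_at_operator p T = (\<lambda>x. 0)"
proof -
  have T0: "T 0 = 0" using lin(2)[of 0 0] by simp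
  have "poly_at_operator (m * q) T x = 0" for q x
  proof (induction q)
    case 0
    then show ?case by (simp add: poly_at_operator_0)
  next
    case (pCons k q)
    have "m * pCons k q = smult k m + pCons 0 (m * q)" by simp
    with pCons show ?case
      by (simp add: poly_at_operator_add poly_at_operator_smult poly_at_operator_pCons lin
        assms(4) T0)
  qed
  with assms(3) show ?thesis by (auto elim!: dvdE)
qed

lemma set_multD: "set_mult U V \<subseteq> W \<Longrightarrow> u \<in> U \<Longrightarrow> v \<in> V \<Longrightarrow> mult u v \<in> W"
  by (auto simp: set_mult_def)

text \<open>Doubling turns the eigenvalues 1, 1/2, 0 of an axis into 2, 1, 0, so that most
  identities below have no denominators. In an associative model \<open>jp x y\<close> is
  \<open>xy + yx\<close>.\<close>

definition jp :: "'a \<Rightarrow> 'a \<Rightarrow> 'a" where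
  "jp x y = scale 2 (mult x y)"

lemma mult_add_right: "mult w (x + y) = mult w x + mult w y"
  by (simp add: mult_comm[of w] mult_add_left)

lemma mult_scale_right: "mult x (scale k y) = scale k (mult x y)"
  by (simp add: mult_comm[of x] mult_scale_left)

lemma mult_minus_right: "mult x (- y) = - mult x y"
  using mult_scale_right[of x "-1" y] by simp

lemma mult_diff_right: "mult w (x - y) = mult w x - mult w y"
  using mult_add_right[of w x "- y"] by (simp add: mult_minus_right)

lemma jp_comm: "jp x y = jp y x"
  by (simp add: jp_def mult_comm)

lemma jp_add_left: "jp (x + y) w = jp x w + jp y w"
  by (simp add: jp_def mult_add_left scale_right_distrib)

lemma jp_add_right: "jp w (x + y) = jp w x + jp w y"
  by (simp add: jp_def mult_add_right scale_right_distrib)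

lemma jp_scale_left: "jp (scale k x) y = scale k (jp x y)"
  by (simp add: jp_def mult_scale_left mult.commute)

lemma jp_scale_right: "jp x (scale k y) = scale k (jp x y)"
  by (simp add: jp_def mult_scale_right mult.commute)

lemma jp_zero_left [simp]: "jp 0 x = 0"
  using jp_scale_left[of 0 0] by simp

lemma jp_zero_right [simp]: "jp x 0 = 0"
  using jp_scale_right[of _ 0 0] by simp

lemma jp_minus_left: "jp (- x) y = - jp x y"
  using jp_scale_left[of "-1"] by simp

lemma jp_minus_right: "jp x (- y) = - jp x y"
  using jp_scale_right[of _ "-1"] by simp

lemma jp_diff_left: "jp (x - y) w = jp x w - jp y w"
  using jp_add_left[of x "-y"] by (simp add: jp_minus_left)

lemma jp_diff_right: "jp w (x - y) = jp w x - jp w y"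
  using jp_add_right[of _ x "-y"] by (simp add: jp_minus_right)

lemmas jp_linear = jp_add_left jp_add_right jp_scale_left jp_scale_right
  jp_minus_left jp_minus_right jp_diff_left jp_diff_right

lemmas scale_distrib = scale_left_distrib scale_right_distrib
  scale_left_diff_distrib scale_right_diff_distrib

lemma scale_two: "scale 2 x = x + x"
  using scale_left_distrib[of 1 1 x] by simp

lemma scale_two_mult: "scale (2 * k) x = scale k x + scale k x"
  by (simp only: mult_2 scale_left_distrib)

end

section \<open>One primitive axis: decomposition, projection coefficient and fusion\<close>

locale half_axis = comm_nonassoc_algebra scale mult
  for scale :: "'f::field \<Rightarrow> 'a::ab_group_add \<Rightarrow> 'a" and mult +
  fixes a :: 'a
  assumes two_neq_0: "(2::'f) \<noteq> 0"
    and axis: "jordan_type_axis (1/2) a"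
    and primitive: "primitive a"
begin

text \<open>Division by two. Many identities below are proved in doubled form, where small multiples
  become repeated summands and additive normalisation suffices.\<close>

lemma double_cancel: "x + x = y + y \<Longrightarrow> x = y" for x y :: 'a
  using scale_cancel_left[of 2 x y] two_neq_0 by (simp add: scale_two)

lemma scale_half_double: "scale (1/2) (x + x) = x"
  using two_neq_0 by (simp flip: scale_two)

lemma mem_eigenspace_1: "x \<in> eigenspace 1 a \<longleftrightarrow> jp a x = scale 2 x"
  using two_neq_0 by (simp add: eigenspace_def ad_def jp_def mult_comm)

lemma mem_eigenspace_0: "x \<in> eigenspace 0 a \<longleftrightarrow> jp a x = 0"
  using two_neq_0 by (simp add: eigenspace_def ad_def jp_def mult_comm)

lemma mem_eigenspace_half: "x \<in> eigenspace (1/2) a \<longleftrightarrow> jp a x = x"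
proof -
  have "mult a x = scale (1/2) x \<longleftrightarrow> scale 2 (mult a x) = scale 2 (scale (1/2) x)"
    by (subst scale_cancel_left) (simp add: two_neq_0)
  then show ?thesis
    using two_neq_0 by (simp add: eigenspace_def ad_def jp_def mult_comm)
qed

lemma fusion:
  "set_mult (eigenspace 0 a) (eigenspace 0 a) \<subseteq> eigenspace 0 a"
  "set_mult (eigenspace 0 a + eigenspace 1 a) (eigenspace (1/2) a) \<subseteq> eigenspace (1/2) a"
  "set_mult (eigenspace (1/2) a) (eigenspace (1/2) a) \<subseteq> eigenspace 0 a + eigenspace 1 a"
  using axis unfolding jordan_type_axis_def by fast+

lemma idem: "jp a a = a + a"
  using axis by (simp add: jordan_type_axis_def jp_def scale_two)

lemma eigenspace_1: "eigenspace 1 a = range (\<lambda>r. scale r a)"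
  using primitive by (simp add: primitive_def span_singleton)

lemma nonzero: "a \<noteq> 0"
proof
  assume "a = 0"
  then have "eigenspace 1 a = {0}" unfolding eigenspace_1 by auto
  moreover have "dim {0} = 0"
    using dim_le_card[of "{0}" "{}"] by simp
  ultimately show False using primitive by (simp add: primitive_def)
qed

text \<open>For \<open>J = jp a\<close>, which is twice \<open>ad a\<close>, the divisibility
  condition on the minimal polynomial reads \<open>(J - 2) J (J - 1) = 0\<close>.\<close>

lemma jp_cubic: "jp a (jp a (jp a x)) = scale 3 (jp a (jp a x)) - scale 2 (jp a x)"
proof -
  obtain m where m: "minimal_polynomial (ad a) m" "m dvd [:-1, 1:] * [:0, 1:] * [:-(1/2), 1:]"
    using axis by (auto simp: jordan_type_axis_def)
  have lin: "ad a (x + y) = ad a x + ad a y" "ad a (scale k x) = scale k (ad a x)" for x y k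
    by (simp_all add: ad_def mult_add_left mult_scale_left)
  have "poly_at_operator ([:-1, 1:] * [:0, 1:] * [:-(1/2), 1:]) (ad a) x = 0"
    using poly_at_operator_dvd[OF lin m(2)] m(1) by (simp add: minimal_polynomial_def)
  moreover have "[:-1, 1:] * [:0, 1:] * [:-(1/2), 1:] = [:0, 1/2, -(3/2), 1::'f:]"
    using two_neq_0 by (simp add: field_simps)
  moreover have "ad a 0 = 0" using lin(2)[of 0 0] by simp
  moreover have "ad a (y - z) = ad a y - ad a z" for y z
    using mult_diff_right[of a y z] by (simp add: ad_def mult_comm)
  ultimately have "scale (1/2) (ad a x) - scale (3/2) (ad a (ad a x)) + ad a (ad a (ad a x)) = 0"
    by (simp add: poly_at_operator_pCons lin poly_at_operator_0 diff_add_eq add_diff_eq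
        del: mult_pCons_left mult_pCons_right)
  \<comment> \<open>Substituting \<open>J / 2\<close> for \<open>ad a\<close> in the cubic produces
    the denominator 8.\<close>
  then have "scale 8 (scale (1/2) (ad a x) - scale (3/2) (ad a (ad a x)) + ad a (ad a (ad a x))) =
    0"
    by simp
  moreover have "(8::'f) * (1 / 2) = 4" "(8::'f) * (3 / 2) = 12"
    using two_neq_0 by (simp_all add: divide_eq_eq)
  ultimately have "scale 4 (ad a x) - scale 12 (ad a (ad a x)) + scale 8 (ad a (ad a (ad a x))) = 0"
    by (simp only: scale_right_distrib scale_right_diff_distrib scale_scale)
  then show ?thesis
    by (simp add: jp_def mult_scale_right ad_def mult_comm[of a] mult_scale_left algebra_simps)
qed

lemma decomposition:
  obtains r x0 xh where "x = scale r a + x0 + xh" "jp a x0 = 0" "jp a xh = xh"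
proof -
  let ?J = "jp a"
  \<comment> \<open>Interpolation at the eigenvalues 2, 0, 1: \<open>x1 = J (J - 1) x\<close> and
    \<open>x0 = (J - 1) (J - 2) x\<close> are twice the respective components of \<open>x\<close>,
    and \<open>xh = J (2 - J) x\<close> is the third component itself.\<close>
  define x1 where "x1 = ?J (?J x) - ?J x"
  define x0 where "x0 = ?J (?J x) - scale 3 (?J x) + scale 2 x"
  define xh where "xh = scale 2 (?J x) - ?J (?J x)"
  have three: "scale 3 y = y + y + y" for y
    using scale_left_distrib[of 2 1 y] by (simp add: scale_two)
  have "?J x1 = scale 2 x1"
    by (simp add: x1_def jp_linear jp_cubic three scale_two)
  then obtain r where r: "x1 = scale r a" using mem_eigenspace_1 eigenspace_1 by auto
  have x0: "?J x0 = 0" by (simp add: x0_def jp_linear jp_cubic three scale_two)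
  have xh: "?J xh = xh" by (simp add: xh_def jp_linear jp_cubic three scale_two)
  have "x = scale (1/2) (x1 + x0 + (xh + xh))"
    using scale_half_double[of x]
    by (simp add: x1_def x0_def xh_def three scale_two algebra_simps)
  then have "x = scale (r/2) a + scale (1/2) x0 + xh"
    by (simp add: r scale_right_distrib[of _ _ "xh + xh"] scale_half_double)
      (simp add: scale_right_distrib)
  then show ?thesis using that x0 xh by (simp add: jp_scale_right)
qed

text \<open>The operator \<open>J (J - 1)\<close> kills \<open>x0\<close> and \<open>xh\<close> and
  multiplies \<open>a\<close> by 2, so \<open>x\<close> determines \<open>r\<close>. Hence the
  description by \<open>THE\<close> in \<open>phi\<close> denotes this scalar.\<close>

lemma phi_unique:
  assumes "x = scale r a + x0 + xh" "jp a x0 = 0" "jp a xh = xh"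
  shows "phi a x = r"
proof -
  have "r' = r" if "x = scale r' a + y0 + yh" "jp a y0 = 0" "jp a yh = yh" for r' y0 yh
  proof -
    have *: "jp a (jp a x) - jp a x = scale 2 (scale r a)"
      using assms by (simp add: jp_linear idem scale_distrib scale_two_mult)
    have "jp a (jp a x) - jp a x = scale 2 (scale r' a)"
      using that by (simp add: jp_linear idem scale_distrib scale_two_mult)
    with * show ?thesis using two_neq_0 nonzero by simp
  qed
  then show ?thesis unfolding phi_def
    by (intro the_equality) (use assms in \<open>(metis mem_eigenspace_0 mem_eigenspace_half)+\<close>)
qed

lemma jp_jp: "jp a (jp a x) = jp a x + scale (2 * phi a x) a"
proof -
  obtain r x0 xh where x: "x = scale r a + x0 + xh" "jp a x0 = 0" "jp a xh = xh"
    by (rule decomposition)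
  then have "phi a x = r" by (rule phi_unique)
  then show ?thesis using x by (simp add: jp_linear idem scale_distrib scale_two_mult)
qed

text \<open>As \<open>a \<noteq> 0\<close>, the scalar can be read off the action of
  \<open>J (J - 1)\<close>; linearity and special values of \<open>phi a\<close> are proved through
  this criterion.\<close>

lemma phi_iff: "phi a x = r \<longleftrightarrow> jp a (jp a x) = jp a x + scale (2 * r) a"
  using nonzero two_neq_0 by (simp add: jp_jp)

lemma phi_add: "phi a (x + y) = phi a x + phi a y"
  by (simp add: phi_iff jp_jp jp_linear scale_left_distrib distrib_left)

lemma phi_scale: "phi a (scale k x) = k * phi a x"
  by (simp add: phi_iff jp_jp jp_linear scale_right_distrib mult.left_commute)

lemma phi_minus: "phi a (- x) = - phi a x"
  using phi_scale[of "-1"] by simp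

lemma phi_diff: "phi a (x - y) = phi a x - phi a y"
  using phi_add[of x "- y"] by (simp add: phi_minus)

lemma phi_self: "phi a a = 1"
  by (simp add: phi_iff idem jp_add_right scale_two)

lemma phi_jp: "phi a (jp a x) = 2 * phi a x"
  by (simp add: phi_iff jp_jp jp_linear idem mult.commute flip: scale_two)

lemmas phi_linear = phi_add phi_scale phi_minus phi_diff phi_self phi_jp

lemma phi_eqI:
  assumes "jp a x = scale (2 * r) a"
  shows "phi a x = r"
  using phi_jp[of x] two_neq_0 by (simp add: assms phi_scale phi_self)

text \<open>The projection on the eigenspace for 1/2: \<open>jp a\<close> kills the component for 0,
  fixes the one for 1/2 and doubles the multiple of \<open>a\<close>, which is then
  subtracted.\<close>

definition half_part :: "'a \<Rightarrow> 'a" where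
  "half_part x = jp a x - scale (2 * phi a x) a"

lemma jp_half_part: "jp a (half_part x) = half_part x"
  by (simp add: half_part_def jp_linear jp_jp idem scale_distrib scale_two_mult)

text \<open>The first assumption encodes that \<open>x\<close> is even, that is, lies in
  \<open>eigenspace 0 a + eigenspace 1 a\<close>: it says that \<open>jp a\<close> kills
  \<open>x - scale r a\<close>.\<close>

lemma jp_even_half:
  assumes "jp a x = scale (2 * r) a" "jp a y = y"
  shows "jp a (jp x y) = jp x y"
proof -
  have "jp a (x - scale r a) = 0"
    using assms by (simp add: jp_linear idem scale_distrib scale_two_mult)
  then have "x - scale r a \<in> eigenspace 0 a" by (simp add: mem_eigenspace_0)
  moreover have "scale r a \<in> eigenspace 1 a" by (auto simp: eigenspace_1)
  ultimately have "x \<in> eigenspace 0 a + eigenspace 1 a"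
    using set_plus_intro by fastforce
  moreover have "y \<in> eigenspace (1/2) a" using assms by (simp add: mem_eigenspace_half)
  ultimately have "mult x y \<in> eigenspace (1/2) a"
    by (rule set_multD[OF fusion(2)])
  then show ?thesis by (simp add: mem_eigenspace_half jp_def mult_scale_right)
qed

lemma jp_half_half:
  assumes "jp a x = x" "jp a y = y"
  shows "jp a (jp x y) = scale (2 * phi a (jp x y)) a"
proof -
  have "x \<in> eigenspace (1/2) a" "y \<in> eigenspace (1/2) a"
    using assms by (simp_all add: mem_eigenspace_half)
  then have "mult x y \<in> eigenspace 0 a + eigenspace 1 a"
    by (rule set_multD[OF fusion(3)])
  then obtain z r where z: "mult x y = z + scale r a" "jp a z = 0"
    by (auto simp: eigenspace_1 set_plus_def mem_eigenspace_0)
  then have "jp a (mult x y) = scale (2 * r) a"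
    by (simp add: jp_linear idem scale_distrib scale_two_mult)
  then have *: "jp a (jp x y) = scale (2 * (2 * r)) a" by (simp add: jp_def[of x] jp_linear)
  from phi_eqI[OF *] * show ?thesis by simp
qed

lemma jp_zero_zero:
  assumes "jp a x = 0" "jp a y = 0"
  shows "jp a (jp x y) = 0"
proof -
  have "x \<in> eigenspace 0 a" "y \<in> eigenspace 0 a"
    using assms by (simp_all add: mem_eigenspace_0)
  then have "mult x y \<in> eigenspace 0 a"
    by (rule set_multD[OF fusion(1)])
  then show ?thesis by (simp add: mem_eigenspace_0 jp_def[of x] jp_linear)
qed

text \<open>Write \<open>x = r a + x0\<close> and \<open>y = t a + y0\<close>. The mixed products
  vanish and \<open>x0 \<circ> y0\<close> is again killed by \<open>a\<close>, so only the multiple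
  of \<open>a\<close> survives.\<close>

lemma jp_even_even:
  assumes "jp a x = scale (2 * r) a" "jp a y = scale (2 * t) a"
  shows "jp a (jp x y) = scale (2 * (2 * (r * t))) a"
proof -
  define x0 y0 where "x0 = x - scale r a" and "y0 = y - scale t a"
  have z: "jp a x0 = 0" "jp a y0 = 0"
    using assms by (simp_all add: x0_def y0_def jp_linear idem scale_distrib scale_two_mult)
  have "jp x0 a = 0" using z(1) jp_comm by metis
  have xy: "x = scale r a + x0" "y = scale t a + y0" by (simp_all add: x0_def y0_def)
  have "jp x y = scale t (scale r (a + a)) + jp x0 y0"
    unfolding xy jp_add_left jp_add_right jp_scale_left jp_scale_right z idem \<open>jp x0 a = 0\<close>
    by simp
  then have "jp a (jp x y) = scale t (scale r (a + a + (a + a)))"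
    by (simp only: jp_add_right jp_scale_right jp_zero_zero[OF z] idem add_0_right)
  also have "a + a + (a + a) = scale (2 * (2 * 1)) a"
    by (simp only: scale_two_mult scale_one)
  also have "scale t (scale r (scale (2 * (2 * 1)) a)) = scale (t * (r * (2 * (2 * 1)))) a"
    by (simp only: scale_scale mult.assoc)
  also have "t * (r * (2 * (2 * 1))) = 2 * (2 * (r * t))" by simp
  finally show ?thesis .
qed

text \<open>Split \<open>x\<close> and \<open>y\<close> into even and half parts. The mixed products
  are fixed by \<open>jp a\<close> and cancel on the right, leaving twice the product of the half
  parts, together with multiples of the half parts and of \<open>a\<close>.\<close>

lemma jp_mult_jp:
  "jp (jp a x) (jp a y) + jp (jp a x) (jp a y) =
     jp x (jp a y) + jp y (jp a x) - jp a (jp x y) +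
     scale (2 * phi a (jp x y)) a + scale (2 * phi a y) (jp a x) + scale (2 * phi a x) (jp a y)"
proof -
  define X Y where "X = x - half_part x" and "Y = y - half_part y"
  have XY: "jp a X = scale (2 * phi a x) a" "jp a Y = scale (2 * phi a y) a"
    by (simp_all add: X_def Y_def jp_linear jp_half_part) (simp_all add: half_part_def)
  have XY_even: "jp a (jp X Y) = scale (2 * phi a (jp X Y)) a"
    using jp_even_even[OF XY] by (simp only: phi_eqI[OF jp_even_even[OF XY]])
  have e: "jp x y = jp X Y + jp X (half_part y) + jp (half_part x) Y
      + jp (half_part x) (half_part y)"
    by (simp add: X_def Y_def jp_linear)
  have h: "jp a (jp X (half_part y)) = jp X (half_part y)"
    by (rule jp_even_half[OF XY(1) jp_half_part])
  have h': "jp a (jp (half_part x) Y) = jp (half_part x) Y"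
    unfolding jp_comm[of "half_part x"] by (rule jp_even_half[OF XY(2) jp_half_part])
  have "phi a (jp X (half_part y)) = 0" "phi a (jp (half_part x) Y) = 0"
    by (simp_all add: phi_iff h h')
  then have "phi a (jp x y) = phi a (jp X Y) + phi a (jp (half_part x) (half_part y))"
    by (simp add: e phi_add)
  then have phi_xy: "scale (2 * phi a (jp x y)) a =
      scale (2 * phi a (jp X Y)) a + scale (2 * phi a (jp (half_part x) (half_part y))) a"
    by (simp only: distrib_left scale_left_distrib)
  have "jp a (jp x y) = scale (2 * phi a (jp x y)) a + jp X (half_part y) + jp (half_part x) Y"
  proof -
    have "jp a (jp x y) = jp a (jp X Y) + jp a (jp X (half_part y)) + jp a (jp (half_part x) Y)
        + jp a (jp (half_part x) (half_part y))"
      by (simp only: e jp_add_right)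
    also have "\<dots> = scale (2 * phi a (jp X Y)) a + jp X (half_part y) + jp (half_part x) Y
        + scale (2 * phi a (jp (half_part x) (half_part y))) a"
      by (simp only: h h' XY_even[symmetric] jp_half_half[OF jp_half_part jp_half_part, symmetric])
    finally show ?thesis unfolding phi_xy by (simp only: ac_simps)
  qed
  then show ?thesis
    by (simp add: X_def Y_def jp_linear half_part_def jp_jp idem scale_distrib scale_two_mult
        jp_comm[of x a] jp_comm[of "jp a x" a] jp_comm[of "jp a x" y] algebra_simps)
qed

end

section \<open>Triples of axes\<close>

context comm_nonassoc_algebra
begin

lemma scale_mult_two: "scale (k * 2) x = scale k x + scale k x"
  by (simp only: mult_2_right scale_left_distrib)

lemma scale_mult_mult_two: "scale (k * (l * 2)) x = scale (k * l) x + scale (k * l) x"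
  by (simp only: mult.assoc[symmetric] scale_mult_two)

text \<open>The Jordan triple product with the first argument in the middle: where
  \<open>jp x y\<close> is \<open>xy + yx\<close> in an associative algebra,
  \<open>triple a x y\<close> is \<open>xay + yax\<close>.\<close>

definition triple :: "'a \<Rightarrow> 'a \<Rightarrow> 'a \<Rightarrow> 'a" where
  "triple a x y = scale (1/2) (jp x (jp a y) + jp y (jp a x) - jp a (jp x y))"

end

context half_axis
begin

lemma phi_zero: "phi a 0 = 0"
  using phi_scale[of 0 0] by simp

lemma triple_double: "triple a x y + triple a x y = jp x (jp a y) + jp y (jp a x) - jp a (jp x y)"
  using two_neq_0 by (simp add: triple_def flip: scale_two)

lemma jp_mult_jp_triple:
  "jp (jp a x) (jp a y) = triple a x y + scale (phi a (jp x y)) a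
     + scale (phi a y) (jp a x) + scale (phi a x) (jp a y)"
  by (rule double_cancel)
    (simp only: jp_mult_jp flip: triple_double, simp add: scale_two_mult scale_mult_two
      algebra_simps)

text \<open>Seress's lemma says that
  \<open>a \<circ> (x \<circ> Y) = (a \<circ> x) \<circ> Y\<close> for even \<open>Y\<close>; it is
  checked on the even and the half part of \<open>x\<close> separately. The claim is the case where
  \<open>Y\<close> is the even part of \<open>y\<close>, written out.\<close>

lemma seress:
  "jp a (jp x (jp a y)) = jp a (jp x y) - jp y (jp a x) + jp (jp a x) (jp a y)"
proof -
  define X Y where "X = x - half_part x" and "Y = y - half_part y"
  have XY: "jp a X = scale (2 * phi a x) a" "jp a Y = scale (2 * phi a y) a"
    by (simp_all add: X_def Y_def jp_linear jp_half_part) (simp_all add: half_part_def)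
  have x: "x = X + half_part x" by (simp add: X_def)
  have h: "jp a (jp (half_part x) Y) = jp (half_part x) Y"
    unfolding jp_comm[of "half_part x"] by (rule jp_even_half[OF XY(2) jp_half_part])
  have "jp a (jp x Y) = jp a (jp X Y) + jp a (jp (half_part x) Y)"
    by (subst x) (simp only: jp_linear)
  also have "\<dots> = jp (jp a X) Y + jp (jp a (half_part x)) Y"
    by (simp only: h jp_even_even[OF XY] jp_half_part XY(1) jp_scale_left XY(2) scale_scale)
      (simp add: mult.left_commute mult.assoc)
  also have "\<dots> = jp (jp a x) Y"
    by (simp only: x[symmetric] flip: jp_add_left jp_add_right)
  finally have "jp a (jp x Y) = jp (jp a x) Y" .
  then show ?thesis
    by (simp add: Y_def half_part_def jp_linear jp_comm[of x a] jp_comm[of "jp a x" a]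
        jp_comm[of "jp a x" y] algebra_simps)
qed

lemma jp_jp_jp:
  "jp a (jp x (jp a y)) + jp a (jp x (jp a y)) =
     jp x (jp a y) + (jp a (jp x y) - jp y (jp a x) + scale (2 * phi a (jp x y)) a
       + scale (2 * phi a y) (jp a x) + scale (2 * phi a x) (jp a y))"
proof -
  have "jp a (jp x (jp a y)) + jp a (jp x (jp a y)) =
      jp a (jp x y) - jp y (jp a x) + (jp a (jp x y) - jp y (jp a x))
      + (jp (jp a x) (jp a y) + jp (jp a x) (jp a y))"
    by (simp only: seress algebra_simps)
  then show ?thesis by (simp add: jp_mult_jp algebra_simps)
qed

lemma jp_jp_jp_triple:
  "jp a (jp x (jp a y)) = jp x (jp a y) - triple a x y + scale (phi a (jp x y)) a
     + scale (phi a y) (jp a x) + scale (phi a x) (jp a y)" (is "?l = ?p - ?t + ?q + ?r + ?s")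
proof (rule double_cancel)
  have "?p - ?t + ?q + ?r + ?s + (?p - ?t + ?q + ?r + ?s) =
      ?p + ?p - (?t + ?t) + (?q + ?q) + (?r + ?r) + (?s + ?s)"
    by (simp only: algebra_simps)
  then show "?l + ?l = ?p - ?t + ?q + ?r + ?s + (?p - ?t + ?q + ?r + ?s)"
    unfolding jp_jp_jp triple_double by (simp add: scale_two_mult algebra_simps)
qed

text \<open>In an associative model this expresses that \<open>axa\<close> is \<open>phi a x\<close>
  times \<open>a\<close>. Here the triple product is expanded, and doubling twice allows
  \<open>jp_jp_jp\<close> to be used at \<open>x, y\<close> and at \<open>y, x\<close>.\<close>

lemma jp_triple: "jp a (triple a x y) = scale (phi a y) (jp a x) + scale (phi a x) (jp a y)"
proof (rule double_cancel)
  have "jp a (triple a x y) + jp a (triple a x y) =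
     jp a (jp x (jp a y)) + jp a (jp y (jp a x)) - jp a (jp a (jp x y))"
    by (simp only: triple_double flip: jp_add_right) (simp only: jp_linear)
  also have "\<dots> = scale (phi a y) (jp a x) + scale (phi a x) (jp a y) +
      (scale (phi a y) (jp a x) + scale (phi a x) (jp a y))" (is "?p + ?q - ?r = ?t")
  proof (rule double_cancel)
    have "?p + ?q - ?r + (?p + ?q - ?r) = (?p + ?p) + (?q + ?q) - (?r + ?r)"
      by (simp only: algebra_simps)
    then show "?p + ?q - ?r + (?p + ?q - ?r) = ?t + ?t"
      unfolding jp_jp_jp jp_jp by (simp add: jp_comm[of y x] scale_two_mult scale_mult_two
        algebra_simps)
  qed
  finally show "jp a (triple a x y) + jp a (triple a x y) =
      scale (phi a y) (jp a x) + scale (phi a x) (jp a y) +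
      (scale (phi a y) (jp a x) + scale (phi a x) (jp a y))" .
qed

text \<open>Applying \<open>phi a\<close> to \<open>jp_jp_jp\<close> at \<open>x, y\<close> and at
  \<open>y, x\<close> gives two linear equations for two unknown scalars. Their difference makes the
  unknowns equal, and either equation then gives four times the value.\<close>

lemma phi_jp_right: "phi a (jp x (jp a y)) = phi a (jp x y) + 2 * phi a x * phi a y"
proof -
  have *: "4 * phi a (jp x (jp a y)) =
      phi a (jp x (jp a y)) + 2 * phi a (jp x y) - phi a (jp y (jp a x))
      + 2 * phi a (jp x y) + 8 * phi a x * phi a y" for x y
    using arg_cong[OF jp_jp_jp[of x y], of "phi a"] by (simp add: phi_linear algebra_simps)
  define p p' where "p = phi a (jp x (jp a y))" and "p' = phi a (jp y (jp a x))"
  have 1: "4 * p = p + 2 * phi a (jp x y) - p' + 2 * phi a (jp x y) + 8 * phi a x * phi a y"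
    using *[of x y] by (simp add: p_def p'_def)
  have 2: "4 * p' = p' + 2 * phi a (jp x y) - p + 2 * phi a (jp x y) + 8 * phi a x * phi a y"
    using *[of y x] by (simp add: p_def p'_def jp_comm[of y x])
  have "2 * (p - p') = 0" using 1 2 by algebra
  then have "p' = p" using two_neq_0 by simp
  with 1 have "2 * (2 * (p - (phi a (jp x y) + 2 * phi a x * phi a y))) = 0" by algebra
  then have "p - (phi a (jp x y) + 2 * phi a x * phi a y) = 0"
    using two_neq_0 by (simp only: mult_eq_0_iff simp_thms)
  then show ?thesis by (simp add: p_def)
qed

text \<open>For the unknown product \<open>w\<close>, \<open>jp_jp_jp\<close> reads
  \<open>2 (a \<circ> w) = w + z\<close>. Multiplying by \<open>a\<close> once more and using
  \<open>jp_jp\<close> gives \<open>a \<circ> w\<close>, hence \<open>w\<close>. Products with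
  \<open>a \<circ> y\<close> are thereby reduced to products with \<open>a\<close> and with
  \<open>y\<close>.\<close>

lemma jp_right_eq:
  fixes x y
  defines "z \<equiv> jp a (jp x y) - jp y (jp a x) + scale (2 * phi a (jp x y)) a
     + scale (2 * phi a y) (jp a x) + scale (2 * phi a x) (jp a y)"
  shows "jp x (jp a y) = scale 2 (jp a z) - z - scale (8 * (phi a (jp x y) + 2 * phi a x * phi a
    y)) a"
proof -
  define w where "w = jp x (jp a y)"
  define r where "r = phi a w"
  have 1: "jp a w + jp a w = w + z"
    using jp_jp_jp[of x y] by (simp add: w_def z_def)
  have "jp a (jp a w) + jp a (jp a w) = jp a w + jp a z"
    using arg_cong[OF 1, of "jp a"] by (simp only: jp_add_right)
  then have 2: "jp a w + scale (4 * r) a = jp a z"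
    by (simp add: jp_jp r_def algebra_simps flip: scale_left_distrib)
  have "w = jp a w + jp a w - z" using 1 by simp
  also have "jp a w = jp a z - scale (4 * r) a" using 2 by (simp add: algebra_simps)
  also have "jp a z - scale (4 * r) a + (jp a z - scale (4 * r) a) - z = scale 2 (jp a z) - z -
    scale (8 * r) a"
    by (simp add: scale_two algebra_simps flip: scale_left_distrib)
  finally show ?thesis by (simp add: w_def r_def phi_jp_right)
qed

end

text \<open>The square of \<open>x \<circ> y\<close> is a combination of \<open>x\<close>,
  \<open>y\<close> and \<open>x \<circ> y\<close>. Exchanging the axes changes only the coefficient
  of \<open>x \<circ> y\<close>, from \<open>2 * phi x y\<close> to \<open>2 * phi y x\<close>. So
  these agree unless \<open>x \<circ> y = 0\<close>, in which case both vanish.\<close>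

lemma (in comm_nonassoc_algebra) phi_commute:
  assumes "half_axis scale mult a" "half_axis scale mult b"
  shows "phi a b = phi b a"
proof -
  have square: "jp (jp x y) (jp x y) =
      scale (2 * phi y x) y + scale (2 * phi x y) x + scale (2 * phi x y) (jp x y)"
    if "half_axis scale mult x" "half_axis scale mult y" for x y
  proof -
    interpret X: half_axis scale mult x by fact
    interpret Y: half_axis scale mult y by fact
    have "triple x y y = scale (2 * phi y x) y"
      by (rule X.double_cancel)
        (simp add: X.triple_double jp_comm[of x y] Y.jp_jp Y.idem jp_linear)
    then show ?thesis
      using X.jp_mult_jp_triple[of y y]
      by (simp add: Y.idem X.phi_linear scale_two_mult scale_mult_two algebra_simps)
  qed
  interpret A: half_axis scale mult a by fact
  interpret B: half_axis scale mult b by fact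
  show ?thesis
  proof (cases "jp a b = 0")
    case True
    then have "jp b a = 0" by (simp add: jp_comm)
    with True have "phi a b = 0" "phi b a = 0"
      by (simp_all add: A.phi_iff B.phi_iff)
    then show ?thesis by simp
  next
    case False
    have "scale (2 * phi a b) (jp a b) = scale (2 * phi b a) (jp a b)"
      using square[OF assms] square[OF assms(2,1)]
      by (simp add: jp_comm[of b a] add.commute)
    with False show ?thesis using A.two_neq_0 by simp
  qed
qed

section \<open>Products of the axes with the nine elements\<close>

locale axis_triple = comm_nonassoc_algebra scale mult
  for scale :: "'f::field \<Rightarrow> 'a::ab_group_add \<Rightarrow> 'a" and mult +
  fixes a b c :: 'a and \<alpha> \<beta> \<gamma> :: 'f
  assumes half_axis_a: "half_axis scale mult a"
    and half_axis_b: "half_axis scale mult b"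
    and half_axis_c: "half_axis scale mult c"
    and phi_a_b: "phi a b = \<alpha>"
    and phi_b_c: "phi b c = \<beta>"
    and phi_c_a: "phi c a = \<gamma>"

sublocale axis_triple \<subseteq> A: half_axis scale mult a by (rule half_axis_a)
sublocale axis_triple \<subseteq> B: half_axis scale mult b by (rule half_axis_b)
sublocale axis_triple \<subseteq> C: half_axis scale mult c by (rule half_axis_c)

context axis_triple
begin

abbreviation f where "f \<equiv> jp b c"
abbreviation g where "g \<equiv> jp c a"
abbreviation h where "h \<equiv> jp a b"
abbreviation u where "u \<equiv> triple a b c"
abbreviation v where "v \<equiv> triple b c a"
abbreviation w where "w \<equiv> triple c a b"

lemma rot: "axis_triple scale mult b c a \<beta> \<gamma> \<alpha>"
  by unfold_locales (fact phi_b_c phi_c_a phi_a_b)+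

lemma phi_b_a: "phi b a = \<alpha>" and phi_c_b: "phi c b = \<beta>" and phi_a_c: "phi a c = \<gamma>"
  using phi_a_b phi_b_c phi_c_a phi_commute half_axis_a half_axis_b half_axis_c by metis+

lemmas phi_values = phi_a_b phi_b_c phi_c_a phi_b_a phi_c_b phi_a_c

text \<open>In the sum of the two doubled triple products the terms \<open>b \<circ> g\<close> and
  \<open>c \<circ> h\<close> cancel and \<open>a \<circ> f\<close> occurs twice.\<close>

lemma a_f: "jp a f = v + w"
proof (rule A.double_cancel)
  have "v + w + (v + w) = (v + v) + (w + w)" by (simp only: ac_simps)
  then show "jp a f + jp a f = v + w + (v + w)"
    unfolding B.triple_double C.triple_double
    by (simp add: jp_comm[of b a] jp_comm[of c b] jp_comm[of a c] algebra_simps)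
qed

lemma a_g: "jp a g = g + scale (2 * \<gamma>) a"
  using A.jp_jp[of c] by (simp add: jp_comm[of a c] phi_values)

lemma a_h: "jp a h = h + scale (2 * \<alpha>) a"
  using A.jp_jp[of b] by (simp add: phi_values)

lemma a_u: "jp a u = scale \<gamma> h + scale \<alpha> g"
  using A.jp_triple[of b c] by (simp add: phi_values jp_comm[of a c])

lemma g_h: "jp g h = u + scale (phi a f) a + scale \<alpha> g + scale \<gamma> h"
  using A.jp_mult_jp_triple[of b c]
  by (simp add: phi_values jp_comm[of a c] jp_comm[of h g] add_ac)

end

text \<open>
  The hypotheses are invariant under the cyclic rotation of \<open>a, b, c\<close>. A fact can be rotated only
    once the
  context in which it was proved has been closed, hence the sequence of short contexts.
\<close>

context axis_triple
begin

lemmas b_g = axis_triple.a_f[OF rot] and b_h = axis_triple.a_g[OF rot]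
  and b_f = axis_triple.a_h[OF rot] and b_v = axis_triple.a_u[OF rot]

end

context axis_triple
begin

lemmas c_h = axis_triple.b_g[OF rot] and c_f = axis_triple.b_h[OF rot]
  and c_g = axis_triple.b_f[OF rot] and c_w = axis_triple.b_v[OF rot]

lemma a_w: "jp a w = w + scale (phi a f) a"
proof -
  \<comment> \<open>By \<open>b_g\<close>, \<open>w + u\<close> is
    \<open>b \<circ> (a \<circ> c)\<close>, so \<open>jp_jp_jp\<close> at \<open>b, c\<close>
    applies; the part belonging to \<open>u\<close> is known from \<open>a_u\<close>.\<close>
  have "jp a (w + u) = w + scale (phi a f) a + scale \<gamma> h + scale \<alpha> g"
    by (rule A.double_cancel)
      (use A.jp_jp_jp[of b c] in \<open>simp add: jp_comm[of a c] b_g a_f c_h phi_values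
        scale_two_mult scale_mult_two algebra_simps\<close>)
  then show ?thesis by (simp add: jp_add_right a_u algebra_simps)
qed

lemma a_v: "jp a v = v + scale (phi a f) a"
proof -
  \<comment> \<open>Likewise \<open>u + v\<close> is \<open>c \<circ> (a \<circ> b)\<close>.\<close>
  have "jp a (u + v) = v + scale (phi a f) a + scale \<gamma> h + scale \<alpha> g"
    by (rule A.double_cancel)
      (use A.jp_jp_jp[of c b] in \<open>simp add: jp_comm[of a c] jp_comm[of c b] b_g a_f c_h phi_values
        scale_two_mult scale_mult_two algebra_simps\<close>)
  then show ?thesis by (simp add: jp_add_right a_u algebra_simps)
qed

end

context axis_triple
begin

lemmas b_u = axis_triple.a_w[OF rot] and b_w = axis_triple.a_v[OF rot]

end

context axis_triple
begin

lemmas c_v = axis_triple.b_u[OF rot] and c_u = axis_triple.b_w[OF rot]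

text \<open>If \<open>h \<noteq> 0\<close>, compute \<open>b \<circ> (g \<circ> h)\<close> once from
  \<open>g_h\<close> and once from the identity of the axis \<open>b\<close>, using
  \<open>h = b \<circ> a\<close>. The results differ only in a multiple of \<open>h\<close>, with
  coefficient \<open>phi a f\<close> in one and \<open>phi b g\<close> in the other. If
  \<open>h = 0\<close>, both scalars vanish by \<open>phi_jp_right\<close>.\<close>

lemma phi_a_f_eq: "phi a f = phi b g"
proof (cases "h = 0")
  case True
  then have "jp b a = 0" by (simp add: jp_comm)
  have "\<alpha> = 0" using True phi_a_b A.phi_iff[of b 0] by simp
  have "phi a f = 0"
    using A.phi_jp_right[of c b] True by (simp add: phi_values \<open>\<alpha> = 0\<close> jp_comm[of c b] A.phi_zero)
  moreover have "phi b g = 0"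
    using B.phi_jp_right[of c a] \<open>jp b a = 0\<close> by (simp add: phi_values \<open>\<alpha> = 0\<close> B.phi_zero)
  ultimately show ?thesis by simp
next
  case False
  have tr: "triple b g a = scale (phi a f) a + scale \<alpha> g"
    by (rule B.double_cancel)
      (simp add: B.triple_double jp_comm[of b a] b_g g_h jp_comm[of g a] a_g jp_linear a_u a_w
        b_h scale_two_mult scale_mult_two algebra_simps)
  have "phi b (jp g a) = phi b g + 2 * \<gamma> * \<alpha>"
    by (simp add: jp_comm[of g a] a_g B.phi_linear phi_values)
  have "jp b (jp g h) = jp g h - triple b g a + scale (phi b g + 2 * \<gamma> * \<alpha>) b
      + scale \<alpha> (w + u) + scale (phi b g) h"
    using B.jp_jp_jp_triple[of g a] \<open>phi b (jp g a) = _\<close>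
    by (simp add: phi_values b_g jp_comm[of b a])
  then have "scale (phi a f) h = scale (phi b g) h"
    by (simp add: tr g_h jp_linear b_u b_g b_h jp_comm[of b a] scale_two_mult scale_mult_two
        scale_mult_mult_two algebra_simps)
  with False show ?thesis by simp
qed

end

section \<open>The multiplication table\<close>

text \<open>Linear independence is not assumed here: the table is an identity between combinations
  and becomes one between coefficients in dimension nine. A separate locale allows the same notation
  for the rotated axes.\<close>

locale nine_vectors = vector_space scale
  for scale :: "'f::field \<Rightarrow> 'a::ab_group_add \<Rightarrow> 'a" +
  fixes a b c f g h u v w :: 'a
begin

definition comb :: "'f \<Rightarrow> 'f \<Rightarrow> 'f \<Rightarrow> 'f \<Rightarrow> 'f \<Rightarrow> 'f \<Rightarrow> 'f \<Rightarrow> 'f \<Rightarrow> 'f \<Rightarrow> 'a" where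
  "comb x1 x2 x3 x4 x5 x6 x7 x8 x9 = scale x1 a + scale x2 b + scale x3 c +
     scale x4 f + scale x5 g + scale x6 h + scale x7 u + scale x8 v + scale x9 w"

lemma comb_add: "comb x1 x2 x3 x4 x5 x6 x7 x8 x9 + comb y1 y2 y3 y4 y5 y6 y7 y8 y9 = comb (x1 +
  y1) (x2 + y2) (x3 + y3) (x4 + y4) (x5 + y5) (x6 + y6) (x7 + y7) (x8 + y8) (x9 + y9)"
  by (simp add: comb_def scale_left_distrib ac_simps)

lemma comb_scale: "scale k (comb x1 x2 x3 x4 x5 x6 x7 x8 x9) = comb (k * x1) (k * x2) (k * x3) (k
  * x4) (k * x5) (k * x6) (k * x7) (k * x8) (k * x9)"
  by (simp add: comb_def scale_right_distrib)

lemma comb_diff: "comb x1 x2 x3 x4 x5 x6 x7 x8 x9 - comb y1 y2 y3 y4 y5 y6 y7 y8 y9 = comb (x1 -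
  y1) (x2 - y2) (x3 - y3) (x4 - y4) (x5 - y5) (x6 - y6) (x7 - y7) (x8 - y8) (x9 - y9)"
  by (simp add: comb_def scale_left_diff_distrib algebra_simps)

lemma comb_eqI:
  assumes "x1 = y1" "x2 = y2" "x3 = y3" "x4 = y4" "x5 = y5" "x6 = y6" "x7 = y7" "x8 = y8" "x9 = y9"
  shows "comb x1 x2 x3 x4 x5 x6 x7 x8 x9 = comb y1 y2 y3 y4 y5 y6 y7 y8 y9"
  by (simp only: assms)

lemma scale_comb:
  "scale k a = comb k 0 0 0 0 0 0 0 0"
  "scale k b = comb 0 k 0 0 0 0 0 0 0"
  "scale k c = comb 0 0 k 0 0 0 0 0 0"
  "scale k f = comb 0 0 0 k 0 0 0 0 0"
  "scale k g = comb 0 0 0 0 k 0 0 0 0"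
  "scale k h = comb 0 0 0 0 0 k 0 0 0"
  "scale k u = comb 0 0 0 0 0 0 k 0 0"
  "scale k v = comb 0 0 0 0 0 0 0 k 0"
  "scale k w = comb 0 0 0 0 0 0 0 0 k"
  by (simp_all add: comb_def)

lemma mem_comb:
  "a = comb 1 0 0 0 0 0 0 0 0"
  "b = comb 0 1 0 0 0 0 0 0 0"
  "c = comb 0 0 1 0 0 0 0 0 0"
  "f = comb 0 0 0 1 0 0 0 0 0"
  "g = comb 0 0 0 0 1 0 0 0 0"
  "h = comb 0 0 0 0 0 1 0 0 0"
  "u = comb 0 0 0 0 0 0 1 0 0"
  "v = comb 0 0 0 0 0 0 0 1 0"
  "w = comb 0 0 0 0 0 0 0 0 1"
  by (simp_all add: comb_def)

lemmas comb_arith = comb_add comb_scale comb_diff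

end

locale axis_triple_psi = axis_triple scale mult a b c \<alpha> \<beta> \<gamma>
  for scale :: "'f::field \<Rightarrow> 'a::ab_group_add \<Rightarrow> 'a" and mult
    and a b c :: 'a and \<alpha> \<beta> \<gamma> :: 'f +
  fixes s :: 'f
  assumes phi_a_f: "phi a f = s"
begin

lemma phi_b_g: "phi b g = s" and phi_c_h: "phi c h = s"
  using phi_a_f phi_a_f_eq axis_triple.phi_a_f_eq[OF rot] by auto

lemma rot_psi: "axis_triple_psi scale mult b c a \<beta> \<gamma> \<alpha> s"
  by (intro axis_triple_psi.intro axis_triple_psi_axioms.intro rot phi_b_g)

text \<open>Apply \<open>phi a\<close> to \<open>a_v\<close>, \<open>a_w\<close> and
  \<open>a_u\<close>; on the left it yields twice the unknown value.\<close>

lemma phi_a_v: "phi a v = s" and phi_a_w: "phi a w = s" and phi_a_u: "phi a u = 2 * \<alpha> * \<gamma>"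
proof -
  show "phi a v = s" "phi a w = s"
    using arg_cong[OF a_v, of "phi a"] arg_cong[OF a_w, of "phi a"]
    by (simp_all add: A.phi_linear phi_a_f)
  have "2 * phi a u = 2 * (2 * \<alpha> * \<gamma>)"
    using arg_cong[OF a_u, of "phi a"]
    by (simp add: A.phi_linear jp_comm[of c a] phi_values algebra_simps)
  then show "phi a u = 2 * \<alpha> * \<gamma>"
    using A.two_neq_0 by (simp only: mult_cancel_left simp_thms)
qed

end

context axis_triple_psi
begin

lemmas phi_b_w = axis_triple_psi.phi_a_v[OF rot_psi] and phi_b_u = axis_triple_psi.phi_a_w[OF
  rot_psi]
  and phi_b_v = axis_triple_psi.phi_a_u[OF rot_psi]

end

context axis_triple_psi
begin

lemmas phi_c_u = axis_triple_psi.phi_b_w[OF rot_psi] and phi_c_v = axis_triple_psi.phi_b_u[OF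
  rot_psi]
  and phi_c_w = axis_triple_psi.phi_b_v[OF rot_psi]

sublocale nine_vectors scale a b c f g h u v w ..

section \<open>Multiplication by each of the nine elements\<close>

lemma a_comb: "jp a (comb x1 x2 x3 x4 x5 x6 x7 x8 x9) =
  comb (2 * x1 + 2 * \<gamma> * x5 + 2 * \<alpha> * x6 + s * x8 + s * x9) 0 0 0
    (x3 + x5 + \<alpha> * x7) (x2 + x6 + \<gamma> * x7) 0 (x4 + x8) (x4 + x9)"
  by (simp add: comb_def[of x1] jp_linear A.idem a_f a_g a_h a_u a_v a_w jp_comm[of a c] phi_a_f)
    (simp add: scale_comb comb_arith algebra_simps flip: scale_two)

lemma b_comb: "jp b (comb x1 x2 x3 x4 x5 x6 x7 x8 x9) =
  comb 0 (2 * x2 + 2 * \<beta> * x4 + 2 * \<alpha> * x6 + s * x7 + s * x9) 0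
    (x3 + x4 + \<alpha> * x8) 0 (x1 + x6 + \<beta> * x8) (x5 + x7) 0 (x5 + x9)"
  by (simp add: comb_def[of x1] jp_linear B.idem b_f b_g b_h b_u b_v b_w jp_comm[of b a] phi_b_g)
    (simp add: scale_comb comb_arith algebra_simps flip: scale_two)

lemma c_comb: "jp c (comb x1 x2 x3 x4 x5 x6 x7 x8 x9) =
  comb 0 0 (2 * x3 + 2 * \<beta> * x4 + 2 * \<gamma> * x5 + s * x7 + s * x8)
    (x2 + x4 + \<gamma> * x9) (x1 + x5 + \<beta> * x9) 0 (x6 + x7) (x6 + x8) 0"
  by (simp add: comb_def[of x1] jp_linear C.idem c_f c_g c_h c_u c_v c_w jp_comm[of c b] phi_c_h)
    (simp add: scale_comb comb_arith algebra_simps flip: scale_two)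

lemma phi_a_comb: "phi a (comb x1 x2 x3 x4 x5 x6 x7 x8 x9) =
   x1 + \<alpha> * x2 + \<gamma> * x3 + s * x4 + 2 * \<gamma> * x5 + 2 * \<alpha> * x6 + 2 * \<alpha> * \<gamma> * x7 + s * x8 + s * x9"
  unfolding comb_def by (simp add: A.phi_linear phi_values phi_a_f phi_a_u phi_a_v phi_a_w
    jp_comm[of c a])

lemma phi_b_comb: "phi b (comb x1 x2 x3 x4 x5 x6 x7 x8 x9) =
   \<alpha> * x1 + x2 + \<beta> * x3 + 2 * \<beta> * x4 + s * x5 + 2 * \<alpha> * x6 + s * x7 + 2 * \<alpha> * \<beta> * x8 + s * x9"
  unfolding comb_def by (simp add: B.phi_linear phi_values phi_b_g phi_b_u phi_b_v phi_b_w
    jp_comm[of a b])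

lemma phi_c_comb: "phi c (comb x1 x2 x3 x4 x5 x6 x7 x8 x9) =
   \<gamma> * x1 + \<beta> * x2 + x3 + 2 * \<beta> * x4 + 2 * \<gamma> * x5 + s * x6 + s * x7 + s * x8 + 2 * \<beta> * \<gamma> * x9"
  unfolding comb_def by (simp add: C.phi_linear phi_values phi_c_h phi_c_u phi_c_v phi_c_w
    jp_comm[of b c])

lemmas comb_a = trans[OF jp_comm a_comb] and comb_b = trans[OF jp_comm b_comb]
  and comb_c = trans[OF jp_comm c_comb]

text \<open>As \<open>f = b \<circ> c\<close>, the elimination \<open>jp_right_eq\<close> for the
  axis \<open>b\<close> expresses this product through multiplications by \<open>b\<close> and
  \<open>c\<close>, which are already tabulated.\<close>

lemma comb_f: "jp (comb x1 x2 x3 x4 x5 x6 x7 x8 x9) f =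
  comb 0 (2 * \<beta> * x2 + 2 * \<beta> * x4 + s * x6 + s * x7 + 2 * \<gamma> * \<beta> * x9)
    (2 * \<beta> * x3 + 2 * \<beta> * x4 + s * x5 + s * x7 + 2 * \<alpha> * \<beta> * x8)
    (x2 + x3 + 2 * \<beta> * x4 + \<gamma> * x5 + \<alpha> * x6 + s * x8 + s * x9)
    (\<beta> * x5 + \<beta> * x9) (\<beta> * x6 + \<beta> * x8) (2 * \<beta> * x7 - \<beta> * x8 - \<beta> * x9)
    (x1 + x6 + \<beta> * x8) (x1 + x5 + \<beta> * x9)"
  unfolding B.jp_right_eq[of _ c] phi_values
  by (simp only: comb_c b_comb c_comb phi_b_comb scale_comb comb_arith, rule comb_eqI)
    (simp_all add: algebra_simps)

text \<open>Rotating the axes permutes the coefficients cyclically within each block of three.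
  Instantiating a rotated fact with the permuted coefficients restores the original order.\<close>

lemma comb_rotate:
  "nine_vectors.comb scale b c a g h f v w u x2 x3 x1 x5 x6 x4 x8 x9 x7 = comb x1 x2 x3 x4 x5 x6
    x7 x8 x9"
proof -
  interpret R: nine_vectors scale b c a g h f v w u ..
  show ?thesis unfolding R.comb_def comb_def by (simp only: ac_simps)
qed

end

context axis_triple_psi
begin

lemmas comb_g = axis_triple_psi.comb_f[OF rot_psi,
  of x2 x3 x1 x5 x6 x4 x8 x9 x7 for x1 x2 x3 x4 x5 x6 x7 x8 x9, unfolded comb_rotate]

end

context axis_triple_psi
begin

lemmas comb_h = axis_triple_psi.comb_g[OF rot_psi,
  of x2 x3 x1 x5 x6 x4 x8 x9 x7 for x1 x2 x3 x4 x5 x6 x7 x8 x9, unfolded comb_rotate]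

lemmas f_comb = trans[OF jp_comm comb_f] and g_comb = trans[OF jp_comm comb_g]
  and h_comb = trans[OF jp_comm comb_h]

text \<open>Twice \<open>u\<close> is \<open>b \<circ> g + c \<circ> h - a \<circ> f\<close>, since
  these three products are \<open>w + u\<close>, \<open>u + v\<close> and \<open>v + w\<close>. Each
  is an axis times an element whose multiplication is known, so \<open>jp_right_eq\<close> applies
  to each.\<close>

lemma comb_u: "jp (comb x1 x2 x3 x4 x5 x6 x7 x8 x9) u =
  comb 0 (s * x2 + s * x4 + 2 * \<alpha> * \<gamma> * x6 + 2 * \<alpha> * \<gamma> * x7 + \<gamma> * s * x9)
    (s * x3 + s * x4 + 2 * \<alpha> * \<gamma> * x5 + 2 * \<alpha> * \<gamma> * x7 + \<alpha> * s * x8)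
    (\<alpha> * \<gamma> * x8 + \<alpha> * \<gamma> * x9 - 2 * \<alpha> * \<gamma> * x7)
    (\<alpha> * x1 + s * x5 + \<alpha> * x6 + \<alpha> * \<beta> * x8 + s * x9)
    (\<gamma> * x1 + \<gamma> * x5 + s * x6 + s * x8 + \<gamma> * \<beta> * x9)
    (x2 + x3 + 2 * \<beta> * x4 + \<gamma> * x5 + \<alpha> * x6 + 2 * s * x7)
    (- \<gamma> * x5 - \<gamma> * x9) (- \<alpha> * x6 - \<alpha> * x8)"
proof (rule A.double_cancel)
  let ?x = "comb x1 x2 x3 x4 x5 x6 x7 x8 x9"
  have "jp ?x u + jp ?x u = jp ?x (jp b g) + jp ?x (jp c h) - jp ?x (jp a f)"
    unfolding b_g c_h a_f by (simp add: jp_linear algebra_simps)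
  also have "\<dots> = comb 0 (s * x2 + s * x4 + 2 * \<alpha> * \<gamma> * x6 + 2 * \<alpha> * \<gamma> * x7 + \<gamma> * s * x9)
    (s * x3 + s * x4 + 2 * \<alpha> * \<gamma> * x5 + 2 * \<alpha> * \<gamma> * x7 + \<alpha> * s * x8)
    (\<alpha> * \<gamma> * x8 + \<alpha> * \<gamma> * x9 - 2 * \<alpha> * \<gamma> * x7)
    (\<alpha> * x1 + s * x5 + \<alpha> * x6 + \<alpha> * \<beta> * x8 + s * x9)
    (\<gamma> * x1 + \<gamma> * x5 + s * x6 + s * x8 + \<gamma> * \<beta> * x9)
    (x2 + x3 + 2 * \<beta> * x4 + \<gamma> * x5 + \<alpha> * x6 + 2 * s * x7)
    (- \<gamma> * x5 - \<gamma> * x9) (- \<alpha> * x6 - \<alpha> * x8) + comb 0 (s * x2 + s * x4 + 2 * \<alpha> * \<gamma> * x6 + 2 * \<alpha> * \<gamma>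
      * x7 + \<gamma> * s * x9)
    (s * x3 + s * x4 + 2 * \<alpha> * \<gamma> * x5 + 2 * \<alpha> * \<gamma> * x7 + \<alpha> * s * x8)
    (\<alpha> * \<gamma> * x8 + \<alpha> * \<gamma> * x9 - 2 * \<alpha> * \<gamma> * x7)
    (\<alpha> * x1 + s * x5 + \<alpha> * x6 + \<alpha> * \<beta> * x8 + s * x9)
    (\<gamma> * x1 + \<gamma> * x5 + s * x6 + s * x8 + \<gamma> * \<beta> * x9)
    (x2 + x3 + 2 * \<beta> * x4 + \<gamma> * x5 + \<alpha> * x6 + 2 * s * x7)
    (- \<gamma> * x5 - \<gamma> * x9) (- \<alpha> * x6 - \<alpha> * x8)"
    unfolding A.jp_right_eq[of _ f] B.jp_right_eq[of _ g] C.jp_right_eq[of _ h] phi_a_f phi_b_g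
      phi_c_h
    by (simp only: comb_f comb_g comb_h f_comb g_comb h_comb a_comb b_comb c_comb a_f b_g c_h
        phi_a_comb phi_b_comb phi_c_comb scale_right_distrib scale_comb comb_arith)
      (rule comb_eqI; simp add: algebra_simps)
  finally show "jp ?x u + jp ?x u = comb 0 (s * x2 + s * x4 + 2 * \<alpha> * \<gamma> * x6 + 2 * \<alpha> * \<gamma> * x7 + \<gamma>
    * s * x9)
    (s * x3 + s * x4 + 2 * \<alpha> * \<gamma> * x5 + 2 * \<alpha> * \<gamma> * x7 + \<alpha> * s * x8)
    (\<alpha> * \<gamma> * x8 + \<alpha> * \<gamma> * x9 - 2 * \<alpha> * \<gamma> * x7)
    (\<alpha> * x1 + s * x5 + \<alpha> * x6 + \<alpha> * \<beta> * x8 + s * x9)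
    (\<gamma> * x1 + \<gamma> * x5 + s * x6 + s * x8 + \<gamma> * \<beta> * x9)
    (x2 + x3 + 2 * \<beta> * x4 + \<gamma> * x5 + \<alpha> * x6 + 2 * s * x7)
    (- \<gamma> * x5 - \<gamma> * x9) (- \<alpha> * x6 - \<alpha> * x8) + comb 0 (s * x2 + s * x4 + 2 * \<alpha> * \<gamma> * x6 + 2 * \<alpha> * \<gamma>
      * x7 + \<gamma> * s * x9)
    (s * x3 + s * x4 + 2 * \<alpha> * \<gamma> * x5 + 2 * \<alpha> * \<gamma> * x7 + \<alpha> * s * x8)
    (\<alpha> * \<gamma> * x8 + \<alpha> * \<gamma> * x9 - 2 * \<alpha> * \<gamma> * x7)
    (\<alpha> * x1 + s * x5 + \<alpha> * x6 + \<alpha> * \<beta> * x8 + s * x9)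
    (\<gamma> * x1 + \<gamma> * x5 + s * x6 + s * x8 + \<gamma> * \<beta> * x9)
    (x2 + x3 + 2 * \<beta> * x4 + \<gamma> * x5 + \<alpha> * x6 + 2 * s * x7)
    (- \<gamma> * x5 - \<gamma> * x9) (- \<alpha> * x6 - \<alpha> * x8)" .
qed

end

context axis_triple_psi
begin

lemmas comb_v = axis_triple_psi.comb_u[OF rot_psi,
  of x2 x3 x1 x5 x6 x4 x8 x9 x7 for x1 x2 x3 x4 x5 x6 x7 x8 x9, unfolded comb_rotate]

end

context axis_triple_psi
begin

lemmas comb_w = axis_triple_psi.comb_v[OF rot_psi,
  of x2 x3 x1 x5 x6 x4 x8 x9 x7 for x1 x2 x3 x4 x5 x6 x7 x8 x9, unfolded comb_rotate]

end

section \<open>Degenerate parameters\<close>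

context axis_triple_psi
begin

section \<open>Spanning and linear independence of the nine elements\<close>

lemma jp_comb: "jp z (comb y1 y2 y3 y4 y5 y6 y7 y8 y9) = scale y1 (jp z a) + scale y2 (jp z b) +
  scale y3 (jp z c) +
     scale y4 (jp z f) + scale y5 (jp z g) + scale y6 (jp z h) + scale y7 (jp z u) +
     scale y8 (jp z v) + scale y9 (jp z w)"
  unfolding comb_def by (simp only: jp_add_right jp_scale_right)

lemmas comb_table = comb_a comb_b comb_c comb_f comb_g comb_h comb_u comb_v comb_w

lemma mult_jp: "mult x y = scale (1/2) (jp x y)"
  using A.two_neq_0 by (simp add: jp_def)

text \<open>By the table the combinations form a subalgebra; it contains the axes and therefore is
  everything.\<close>

lemma comb_spans:
  assumes "generated_by {a, b, c}"
  obtains x1 x2 x3 x4 x5 x6 x7 x8 x9 where "x = comb x1 x2 x3 x4 x5 x6 x7 x8 x9"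
proof -
  let ?S = "{z. \<exists>x1 x2 x3 x4 x5 x6 x7 x8 x9. z = comb x1 x2 x3 x4 x5 x6 x7 x8 x9}"
  have zero: "0 = comb 0 0 0 0 0 0 0 0 0" by (simp add: comb_def)
  have "subspace ?S"
  proof (rule subspaceI)
    show "0 \<in> ?S" using zero by blast
    show "y + z \<in> ?S" if yz: "y \<in> ?S" "z \<in> ?S" for y z
    proof -
      obtain x1 x2 x3 x4 x5 x6 x7 x8 x9 where "y = comb x1 x2 x3 x4 x5 x6 x7 x8 x9" using yz(1) by
        blast
      moreover obtain y1 y2 y3 y4 y5 y6 y7 y8 y9 where "z = comb y1 y2 y3 y4 y5 y6 y7 y8 y9" using
        yz(2) by blast
      ultimately show ?thesis by (simp only: comb_add mem_Collect_eq) (intro exI, rule refl)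
    qed
    show "scale k z \<in> ?S" if z: "z \<in> ?S" for k z
    proof -
      obtain x1 x2 x3 x4 x5 x6 x7 x8 x9 where "z = comb x1 x2 x3 x4 x5 x6 x7 x8 x9" using z by blast
      then show ?thesis by (simp only: comb_scale mem_Collect_eq) (intro exI, rule refl)
    qed
  qed
  moreover have "mult y z \<in> ?S" if yz: "y \<in> ?S" "z \<in> ?S" for y z
  proof -
    obtain x1 x2 x3 x4 x5 x6 x7 x8 x9 where y: "y = comb x1 x2 x3 x4 x5 x6 x7 x8 x9" using yz(1)
      by blast
    obtain y1 y2 y3 y4 y5 y6 y7 y8 y9 where "z = comb y1 y2 y3 y4 y5 y6 y7 y8 y9" using yz(2) by
      blast
    then have "mult y z = scale (1/2) (scale y1 (jp y a) + scale y2 (jp y b) + scale y3 (jp y c) +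
       scale y4 (jp y f) + scale y5 (jp y g) + scale y6 (jp y h) + scale y7 (jp y u) +
       scale y8 (jp y v) + scale y9 (jp y w))"
      by (simp only: mult_jp jp_comb)
    moreover have "jp y a \<in> ?S" "jp y b \<in> ?S" "jp y c \<in> ?S" "jp y f \<in> ?S" "jp y g \<in> ?S"
        "jp y h \<in> ?S" "jp y u \<in> ?S" "jp y v \<in> ?S" "jp y w \<in> ?S"
      unfolding y comb_table mem_Collect_eq by ((intro exI)?, rule refl)+
    ultimately show ?thesis using \<open>subspace ?S\<close>
      by (simp only: subspace_add subspace_scale)
  qed
  ultimately have "subalgebra ?S" unfolding subalgebra_def set_mult_def by blast
  moreover have "a \<in> ?S" "b \<in> ?S" "c \<in> ?S"
    by (rule CollectI, intro exI, rule mem_comb)+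
  ultimately have "\<Inter>{S. subalgebra S \<and> {a, b, c} \<subseteq> S} \<subseteq> ?S"
    by (intro Inter_lower CollectI conjI) simp_all
  then have "x \<in> ?S" using assms unfolding generated_by_def by blast
  then show ?thesis using that by (elim CollectE exE)
qed

text \<open>A spanning list of length nine in dimension nine has no repetition and is
  independent.\<close>

lemma comb_eq_0:
  assumes gen: "generated_by {a, b, c}" and dim: "dim (UNIV :: 'a set) = 9"
    and z: "comb x1 x2 x3 x4 x5 x6 x7 x8 x9 = 0"
  shows "x1 = 0 \<and> x2 = 0 \<and> x3 = 0 \<and> x4 = 0 \<and> x5 = 0 \<and> x6 = 0 \<and> x7 = 0 \<and> x8 = 0 \<and> x9 = 0"
proof -
  define vs where "vs = [a, b, c, f, g, h, u, v, w]"
  let ?S = "set vs"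
  have S: "a \<in> span ?S" "b \<in> span ?S" "c \<in> span ?S" "f \<in> span ?S" "g \<in> span ?S"
    "h \<in> span ?S" "u \<in> span ?S" "v \<in> span ?S" "w \<in> span ?S"
    by (rule span_base, simp add: vs_def)+
  have "x \<in> span ?S" for x
    by (rule comb_spans[OF gen, of x]) (simp only: comb_def S span_add span_scale)
  then have span: "UNIV \<subseteq> span ?S" by blast
  have "9 \<le> card ?S" using dim_le_card[OF span] dim by (simp only: finite_set simp_thms)
  moreover have "length vs = 9" by (simp add: vs_def)
  ultimately have card: "card ?S = length vs" using card_length[of vs] by simp
  have distinct: "distinct vs" using card by (rule card_distinct)
  have indep: "independent ?S"
  proof
    assume "dependent ?S"
    \<comment> \<open>Removing a redundant element would leave a spanning set of eight.\<close>
    then obtain y where y: "y \<in> ?S" "y \<in> span (?S - {y})"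
      unfolding dependent_def by blast
    then have "span ?S = span (?S - {y})"
      using span_redundant[of y "?S - {y}"] by (simp only: insert_Diff)
    then have "dim (UNIV :: 'a set) \<le> card (?S - {y})"
      using span by (intro dim_le_card) auto
    with y(1) card \<open>length vs = 9\<close> dim show False by simp
  qed
  \<comment> \<open>The coefficients as a function on vectors, as \<open>independentD\<close>
    expects; it takes the intended values because the nine vectors are distinct.\<close>
  define q where "q y = (if y = a then x1 else if y = b then x2 else if y = c then x3 else
    if y = f then x4 else if y = g then x5 else if y = h then x6 else if y = u then x7 else
    if y = v then x8 else x9)" for y
  have neq: "a \<noteq> b" "a \<noteq> c" "a \<noteq> f" "a \<noteq> g" "a \<noteq> h" "a \<noteq> u" "a \<noteq> v" "a \<noteq> w"
    "b \<noteq> c" "b \<noteq> f" "b \<noteq> g" "b \<noteq> h" "b \<noteq> u" "b \<noteq> v" "b \<noteq> w"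
    "c \<noteq> f" "c \<noteq> g" "c \<noteq> h" "c \<noteq> u" "c \<noteq> v" "c \<noteq> w"
    "f \<noteq> g" "f \<noteq> h" "f \<noteq> u" "f \<noteq> v" "f \<noteq> w" "g \<noteq> h" "g \<noteq> u" "g \<noteq> v" "g \<noteq> w"
    "h \<noteq> u" "h \<noteq> v" "h \<noteq> w" "u \<noteq> v" "u \<noteq> w" "v \<noteq> w"
    using distinct by (simp_all add: vs_def)
  have q: "q a = x1" "q b = x2" "q c = x3" "q f = x4" "q g = x5" "q h = x6"
    "q u = x7" "q v = x8" "q w = x9"
    unfolding q_def by (simp_all only: neq neq[symmetric] if_True if_False simp_thms)
  have "(\<Sum>y\<in>?S. scale (q y) y) = (\<Sum>y\<leftarrow>vs. scale (q y) y)"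
    using distinct by (rule sum_list_distinct_conv_sum_set[symmetric])
  also have "\<dots> = comb x1 x2 x3 x4 x5 x6 x7 x8 x9"
    unfolding vs_def comb_def by (simp add: q ac_simps)
  finally have "q y = 0" if "y \<in> ?S" for y
    using independentD[OF indep, of ?S q y] that z by simp
  then have "q a = 0" "q b = 0" "q c = 0" "q f = 0" "q g = 0" "q h = 0" "q u = 0" "q v = 0" "q w =
    0"
    by (simp_all add: vs_def)
  then show ?thesis unfolding q by blast
qed

lemma comb_inject:
  assumes "generated_by {a, b, c}" "dim (UNIV :: 'a set) = 9"
    and "comb x1 x2 x3 x4 x5 x6 x7 x8 x9 = comb y1 y2 y3 y4 y5 y6 y7 y8 y9"
  shows "x1 = y1 \<and> x2 = y2 \<and> x3 = y3 \<and> x4 = y4 \<and> x5 = y5 \<and> x6 = y6 \<and> x7 = y7 \<and> x8 = y8 \<and> x9 = y9"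
proof -
  have "comb (x1 - y1) (x2 - y2) (x3 - y3) (x4 - y4) (x5 - y5) (x6 - y6) (x7 - y7) (x8 - y8) (x9 -
    y9) = 0"
    using assms(3) by (simp flip: comb_diff)
  from comb_eq_0[OF assms(1,2) this] show ?thesis by simp
qed

lemma jp_mem_subspace:
  assumes gen: "generated_by {a, b, c}" and "subspace I"
    and "jp z a \<in> I" "jp z b \<in> I" "jp z c \<in> I" "jp z f \<in> I" "jp z g \<in> I" "jp z h \<in> I"
      "jp z u \<in> I" "jp z v \<in> I" "jp z w \<in> I"
  shows "jp z y \<in> I"
  by (rule comb_spans[OF gen, of y])
    (simp only: jp_comb assms subspace_add[OF assms(2)] subspace_scale[OF assms(2)])

lemma comb_0: "comb 0 0 0 0 0 0 0 0 0 = 0"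
  by (simp add: comb_def)

text \<open>The annihilating element corresponds to the adjugate of the Gram matrix of the axes.\<close>

lemma not_simple_if_det_0:
  assumes gen: "generated_by {a, b, c}" and dim: "dim (UNIV :: 'a set) = 9"
    and det: "\<alpha> + \<beta> + \<gamma> - s - 1 = 0"
  shows "\<not> simple_algebra"
proof
  assume simple: "simple_algebra"
  define z where "z = comb (1 - \<beta>) (1 - \<gamma>) (1 - \<alpha>) (-1) (-1) (-1) 1 1 1"
  have s: "s = \<alpha> + \<beta> + \<gamma> - 1" using det by (simp add: algebra_simps)
  have za: "jp z a = 0" "jp z b = 0" "jp z c = 0" "jp z f = 0" "jp z g = 0" "jp z h = 0"
    "jp z u = 0" "jp z v = 0" "jp z w = 0"
    unfolding comb_0[symmetric] z_def comb_table by (rule comb_eqI; simp add: s algebra_simps)+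
  have "jp z y \<in> {0}" for y
    by (rule jp_mem_subspace[OF gen subspace_single_0]; simp add: za)
  then have "mult z y = 0" for y by (simp add: mult_jp)
  then have "mult y y' = 0" if "y \<in> span {z}" for y y'
    using that unfolding span_singleton by (auto simp: mult_scale_left)
  then have "algebra_ideal (span {z})"
    unfolding algebra_ideal_def set_mult_def using subspace_span span_zero by fastforce
  then have "span {z} = {0} \<or> span {z} = UNIV" using simple unfolding simple_algebra_def by blast
  moreover have "z \<noteq> 0"
    using comb_eq_0[OF gen dim, of "1 - \<beta>" "1 - \<gamma>" "1 - \<alpha>" "-1" "-1" "-1" 1 1 1] by (auto simp:
      z_def)
  then have "span {z} \<noteq> {0}" using span_base[of z "{z}"] by blast
  moreover have "a \<notin> span {z}"
  proof
    assume "a \<in> span {z}"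
    then obtain k where "comb 1 0 0 0 0 0 0 0 0 = scale k z"
      unfolding span_singleton mem_comb(1)[symmetric] by blast
    from comb_inject[OF gen dim this[unfolded z_def comb_scale]] show False by auto
  qed
  ultimately show False by blast
qed

text \<open>The three pairs of conditions are linear systems in \<open>(x4, x7)\<close>,
  \<open>(x5, x8)\<close> and \<open>(x6, x9)\<close>. Each has determinant
  \<open>4 * \<alpha> * \<beta> * \<gamma> - s\<^sup>2\<close>, so nonzero solutions exist when the
  discriminant vanishes.\<close>

definition rad :: "'a set" where
  "rad = {z. \<exists>x4 x5 x6 x7 x8 x9. z = comb 0 0 0 x4 x5 x6 x7 x8 x9 \<and>
     2 * \<beta> * x4 + s * x7 = 0 \<and> s * x4 + 2 * \<alpha> * \<gamma> * x7 = 0 \<and>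
     2 * \<gamma> * x5 + s * x8 = 0 \<and> s * x5 + 2 * \<alpha> * \<beta> * x8 = 0 \<and>
     2 * \<alpha> * x6 + s * x9 = 0 \<and> s * x6 + 2 * \<beta> * \<gamma> * x9 = 0}"

lemma radI:
  assumes "x1 = 0" "x2 = 0" "x3 = 0" "2 * \<beta> * x4 + s * x7 = 0" "s * x4 + 2 * \<alpha> * \<gamma> * x7 = 0"
    "2 * \<gamma> * x5 + s * x8 = 0" "s * x5 + 2 * \<alpha> * \<beta> * x8 = 0"
    "2 * \<alpha> * x6 + s * x9 = 0" "s * x6 + 2 * \<beta> * \<gamma> * x9 = 0"
  shows "comb x1 x2 x3 x4 x5 x6 x7 x8 x9 \<in> rad"
  unfolding rad_def using assms by blast

lemma radE:
  assumes "z \<in> rad"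
  obtains x4 x5 x6 x7 x8 x9 where "z = comb 0 0 0 x4 x5 x6 x7 x8 x9"
    "2 * \<beta> * x4 + s * x7 = 0" "s * x4 + 2 * \<alpha> * \<gamma> * x7 = 0"
    "2 * \<gamma> * x5 + s * x8 = 0" "s * x5 + 2 * \<alpha> * \<beta> * x8 = 0"
    "2 * \<alpha> * x6 + s * x9 = 0" "s * x6 + 2 * \<beta> * \<gamma> * x9 = 0"
  using assms unfolding rad_def by (elim CollectE exE conjE)

lemma subspace_rad: "subspace rad"
proof (rule subspaceI)
  show "0 \<in> rad" unfolding comb_0[symmetric] by (rule radI; simp)
  show "y + z \<in> rad" if "y \<in> rad" "z \<in> rad" for y z
  proof (rule radE[OF that(1)], rule radE[OF that(2)])
    fix x4 x5 x6 x7 x8 x9 y4 y5 y6 y7 y8 y9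
    assume "y = comb 0 0 0 x4 x5 x6 x7 x8 x9" "z = comb 0 0 0 y4 y5 y6 y7 y8 y9"
      and x: "2 * \<beta> * x4 + s * x7 = 0" "s * x4 + 2 * \<alpha> * \<gamma> * x7 = 0"
      "2 * \<gamma> * x5 + s * x8 = 0" "s * x5 + 2 * \<alpha> * \<beta> * x8 = 0"
      "2 * \<alpha> * x6 + s * x9 = 0" "s * x6 + 2 * \<beta> * \<gamma> * x9 = 0"
      and y: "2 * \<beta> * y4 + s * y7 = 0" "s * y4 + 2 * \<alpha> * \<gamma> * y7 = 0"
      "2 * \<gamma> * y5 + s * y8 = 0" "s * y5 + 2 * \<alpha> * \<beta> * y8 = 0"
      "2 * \<alpha> * y6 + s * y9 = 0" "s * y6 + 2 * \<beta> * \<gamma> * y9 = 0"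
    then have e: "y + z = comb (0+0) (0+0) (0+0) (x4 + y4) (x5 + y5) (x6 + y6) (x7 + y7) (x8 + y8)
      (x9 + y9)"
      by (simp only: comb_add)
    show ?thesis unfolding e
      by (rule radI; ((simp; fail) | use x(1) y(1) in algebra | use x(2) y(2) in algebra | use
        x(3) y(3) in algebra
        | use x(4) y(4) in algebra | use x(5) y(5) in algebra | use x(6) y(6) in algebra))
  qed
  show "scale k z \<in> rad" if "z \<in> rad" for k z
  proof (rule radE[OF that])
    fix x4 x5 x6 x7 x8 x9
    assume "z = comb 0 0 0 x4 x5 x6 x7 x8 x9"
      and x: "2 * \<beta> * x4 + s * x7 = 0" "s * x4 + 2 * \<alpha> * \<gamma> * x7 = 0"
      "2 * \<gamma> * x5 + s * x8 = 0" "s * x5 + 2 * \<alpha> * \<beta> * x8 = 0"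
      "2 * \<alpha> * x6 + s * x9 = 0" "s * x6 + 2 * \<beta> * \<gamma> * x9 = 0"
    then have e: "scale k z = comb (k*0) (k*0) (k*0) (k * x4) (k * x5) (k * x6) (k * x7) (k * x8)
      (k * x9)"
      by (simp only: comb_scale)
    show ?thesis unfolding e
      by (rule radI; ((simp; fail) | use x(1) in algebra | use x(2) in algebra | use x(3) in algebra
        | use x(4) in algebra | use x(5) in algebra | use x(6) in algebra))
  qed
qed

text \<open>It suffices to multiply \<open>z\<close> by the nine spanning elements. The conditions
  on each product follow from the conditions on \<open>z\<close> cited with it.\<close>

lemma jp_rad:
  assumes gen: "generated_by {a, b, c}" and disc: "s\<^sup>2 = 4 * \<alpha> * \<beta> * \<gamma>" and "z \<in> rad"
  shows "jp z y \<in> rad"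
proof (rule radE[OF \<open>z \<in> rad\<close>])
  fix x4 x5 x6 x7 x8 x9
  assume e: "z = comb 0 0 0 x4 x5 x6 x7 x8 x9"
    and x: "2 * \<beta> * x4 + s * x7 = 0" "s * x4 + 2 * \<alpha> * \<gamma> * x7 = 0"
    "2 * \<gamma> * x5 + s * x8 = 0" "s * x5 + 2 * \<alpha> * \<beta> * x8 = 0"
    "2 * \<alpha> * x6 + s * x9 = 0" "s * x6 + 2 * \<beta> * \<gamma> * x9 = 0"
  show ?thesis
  proof (rule jp_mem_subspace[OF gen subspace_rad])
    show "jp z a \<in> rad"
      unfolding e comb_table
      by (rule radI, use x(3,5) in algebra,
        simp,
        simp,
        simp,
        simp,
        use x(2,3) in algebra,
        use x(1,4) in algebra,
        use x(2,5) in algebra,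
        use x(1,6) in algebra)
    show "jp z b \<in> rad"
      unfolding e comb_table
      by (rule radI, simp,
        use x(1,5) in algebra,
        simp,
        use x(1,4) in algebra,
        use x(2,3) in algebra,
        simp,
        simp,
        use x(4,5) in algebra,
        use x(3,6) in algebra)
    show "jp z c \<in> rad"
      unfolding e comb_table
      by (rule radI, simp,
        simp,
        use x(1,3) in algebra,
        use x(1,6) in algebra,
        use x(2,5) in algebra,
        use x(3,6) in algebra,
        use x(4,5) in algebra,
        simp,
        simp)
    show "jp z f \<in> rad"
      unfolding e comb_table
      by (rule radI, simp,
        use x(1,6) in algebra,
        use x(1,4) in algebra,
        use x(1,3,5) in algebra,
        use x(2,3,4,5,6) in algebra,
        use x(3,6) in algebra,
        use x(4,5) in algebra,
        use x(4,5) in algebra,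
        use x(3,6) in algebra)
    show "jp z g \<in> rad"
      unfolding e comb_table
      by (rule radI, use x(3,6) in algebra,
        simp,
        use x(2,3) in algebra,
        use x(1,6) in algebra,
        use x(2,5) in algebra,
        use x(1,3,5) in algebra,
        use x(1,2,4,5,6) in algebra,
        use x(2,5) in algebra,
        use x(1,6) in algebra)
    show "jp z h \<in> rad"
      unfolding e comb_table
      by (rule radI, use x(4,5) in algebra,
        use x(2,5) in algebra,
        simp,
        use x(1,4) in algebra,
        use x(2,3) in algebra,
        use x(2,3) in algebra,
        use x(1,4) in algebra,
        use x(1,3,5) in algebra,
        use x(1,2,3,4,6) in algebra)
    show "jp z u \<in> rad"
      unfolding e comb_table
      by (rule radI, simp,
        use x(2,5) in algebra,
        use x(2,3) in algebra,
        use x(1,2,4,6) in algebra,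
        use x(1,3,5) in algebra,
        use x(4,5) in algebra,
        use x(3,4,5,6) in algebra,
        use x(3,6) in algebra,
        use x(3,4,5,6) in algebra)
    show "jp z v \<in> rad"
      unfolding e comb_table
      by (rule radI, use x(4,5) in algebra,
        simp,
        use x(1,4) in algebra,
        use x(2,5) in algebra,
        use x(1,2,5,6) in algebra,
        use x(2,3,4,6) in algebra,
        use x(1,3,5) in algebra,
        use x(1,6) in algebra,
        use x(1,2,5,6) in algebra)
    show "jp z w \<in> rad"
      unfolding e comb_table
      by (rule radI, use x(3,6) in algebra,
        use x(1,6) in algebra,
        simp,
        use x(2,3) in algebra,
        use x(1,2,3,4) in algebra,
        use x(1,4) in algebra,
        use x(1,2,3,4) in algebra,
        use x(2,4,5,6) in algebra,
        use x(1,3,5) in algebra)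
  qed
qed

lemma not_simple_if_disc_0:
  assumes gen: "generated_by {a, b, c}" and dim: "dim (UNIV :: 'a set) = 9"
    and disc: "s\<^sup>2 = 4 * \<alpha> * \<beta> * \<gamma>"
  shows "\<not> simple_algebra"
proof
  assume simple: "simple_algebra"
  have closed: "mult z y \<in> rad" if z: "z \<in> rad" for z y
  proof -
    have "jp z y \<in> rad" by (rule jp_rad[OF gen disc z])
    then show ?thesis by (simp only: mult_jp subspace_scale[OF subspace_rad])
  qed
  have "set_mult rad UNIV \<subseteq> rad"
    unfolding set_mult_def using closed by blast
  then have "algebra_ideal rad"
    unfolding algebra_ideal_def using subspace_rad by blast
  then have "rad = {0} \<or> rad = UNIV" using simple unfolding simple_algebra_def by blast
  moreover have "\<exists>z\<in>rad. z \<noteq> 0"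
  proof (cases "s = 0 \<and> \<beta> = 0")
    case True
    \<comment> \<open>In this case no condition restricts \<open>x4\<close>, so \<open>f\<close>
      itself lies in \<open>rad\<close>.\<close>
    then have "comb 0 0 0 1 0 0 0 0 0 \<in> rad" by (intro radI) simp_all
    moreover have "comb 0 0 0 1 0 0 0 0 0 \<noteq> 0"
      using comb_eq_0[OF gen dim, of 0 0 0 1 0 0 0 0 0] by auto
    ultimately show ?thesis by blast
  next
    case False
    \<comment> \<open>This pair solves the first equation identically; the second becomes the
      vanishing of the discriminant.\<close>
    have "comb 0 0 0 (-s) 0 0 (2 * \<beta>) 0 0 \<in> rad"
      by (rule radI; ((simp; fail) | use disc in algebra))
    moreover have "comb 0 0 0 (-s) 0 0 (2 * \<beta>) 0 0 \<noteq> 0"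
      using comb_eq_0[OF gen dim, of 0 0 0 "-s" 0 0 "2 * \<beta>" 0 0] False A.two_neq_0 by auto
    ultimately show ?thesis by blast
  qed
  moreover have "a \<notin> rad"
  proof
    assume "a \<in> rad"
    then obtain x4 x5 x6 x7 x8 x9 where "comb 1 0 0 0 0 0 0 0 0 = comb 0 0 0 x4 x5 x6 x7 x8 x9"
      unfolding mem_comb(1)[symmetric] by (rule radE)
    from comb_inject[OF gen dim this] show False by simp
  qed
  ultimately show False by blast
qed

end

section \<open>Matrices with a sandwich product\<close>

lemma mat3_eqI:
  fixes M N :: "'k^3^3"
  assumes "M $ 1 $ 1 = N $ 1 $ 1" "M $ 1 $ 2 = N $ 1 $ 2" "M $ 1 $ 3 = N $ 1 $ 3"
    "M $ 2 $ 1 = N $ 2 $ 1" "M $ 2 $ 2 = N $ 2 $ 2" "M $ 2 $ 3 = N $ 2 $ 3"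
    "M $ 3 $ 1 = N $ 3 $ 1" "M $ 3 $ 2 = N $ 3 $ 2" "M $ 3 $ 3 = N $ 3 $ 3"
  shows "M = N"
  using assms by (simp add: vec_eq_iff forall_3)

definition mat3 :: "'k \<Rightarrow> 'k \<Rightarrow> 'k \<Rightarrow> 'k \<Rightarrow> 'k \<Rightarrow> 'k \<Rightarrow> 'k \<Rightarrow> 'k \<Rightarrow> 'k::zero \<Rightarrow> 'k^3^3" where
  "mat3 m11 m12 m13 m21 m22 m23 m31 m32 m33 =
     vector [vector [m11, m12, m13], vector [m21, m22, m23], vector [m31, m32, m33]]"

lemma mat3_nth [simp]:
  "mat3 m11 m12 m13 m21 m22 m23 m31 m32 m33 $ 1 $ 1 = m11"
  "mat3 m11 m12 m13 m21 m22 m23 m31 m32 m33 $ 1 $ 2 = m12"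
  "mat3 m11 m12 m13 m21 m22 m23 m31 m32 m33 $ 1 $ 3 = m13"
  "mat3 m11 m12 m13 m21 m22 m23 m31 m32 m33 $ 2 $ 1 = m21"
  "mat3 m11 m12 m13 m21 m22 m23 m31 m32 m33 $ 2 $ 2 = m22"
  "mat3 m11 m12 m13 m21 m22 m23 m31 m32 m33 $ 2 $ 3 = m23"
  "mat3 m11 m12 m13 m21 m22 m23 m31 m32 m33 $ 3 $ 1 = m31"
  "mat3 m11 m12 m13 m21 m22 m23 m31 m32 m33 $ 3 $ 2 = m32"
  "mat3 m11 m12 m13 m21 m22 m23 m31 m32 m33 $ 3 $ 3 = m33"
  by (simp_all add: mat3_def)

lemma matrix_mult_3_nth:
  fixes M N :: "'k::semiring_1^3^3"
  shows "(M ** N) $ i $ j = M $ i $ 1 * N $ 1 $ j + M $ i $ 2 * N $ 2 $ j + M $ i $ 3 * N $ 3 $ j"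
  by (simp add: matrix_matrix_mult_def sum_3)

lemma matrix_mult_add_left: "(X + Y) ** Z = X ** Z + Y ** Z"
  for X Y Z :: "'k::semiring_1^3^3"
  by (rule mat3_eqI; simp add: matrix_mult_3_nth algebra_simps)

lemma mat_smult_nth: "mat_smult c X $ i $ j = c * X $ i $ j"
  by (simp add: mat_smult_def map_matrix_def)

lemma mat_smult_mult_left: "mat_smult c X ** Y = mat_smult c (X ** Y)"
  for X Y :: "'k::comm_semiring_1^3^3"
  by (rule mat3_eqI; simp add: matrix_mult_3_nth mat_smult_nth algebra_simps)

lemma mat_smult_mult_right: "X ** mat_smult c Y = mat_smult c (X ** Y)"
  for X Y :: "'k::comm_semiring_1^3^3"
  by (rule mat3_eqI; simp add: matrix_mult_3_nth mat_smult_nth algebra_simps)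

text \<open>A Munn algebra: matrices multiplied by \<open>M ** gram ** N\<close>. In the application
  \<open>p * k\<close> is \<gamma> and \<open>p + \<alpha> * \<beta> * k\<close> is
  \<open>s\<close>; thus \<open>p\<close> and \<open>\<alpha> * \<beta> * k\<close> are the roots of
  \<open>X\<^sup>2 - s X + \<alpha> * \<beta> * \<gamma>\<close>.\<close>

locale munn =
  fixes \<alpha> \<beta> p k :: "'k::field"
begin

definition gram :: "'k^3^3" where
  "gram = mat3 1 1 k \<alpha> 1 1 p \<beta> 1"

definition gram_det :: 'k where
  "gram_det = 1 - \<alpha> - \<beta> - p * k + p + \<alpha> * \<beta> * k"

definition gram_inv :: "'k^3^3" where
  "gram_inv = mat_smult (1 / gram_det) (mat3 (1 - \<beta>) (k * \<beta> - 1) (1 - k)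
     (p - \<alpha>) (1 - k * p) (k * \<alpha> - 1) (\<alpha> * \<beta> - p) (p - \<beta>) (1 - \<alpha>))"

text \<open>The axes are sent to the matrix units with respect to the product \<open>M ** gram ** N\<close>.\<close>

definition coeffs :: "'k \<Rightarrow> 'k \<Rightarrow> 'k \<Rightarrow> 'k \<Rightarrow> 'k \<Rightarrow> 'k \<Rightarrow> 'k \<Rightarrow> 'k \<Rightarrow> 'k \<Rightarrow> 'k^3^3" where
  "coeffs x1 x2 x3 x4 x5 x6 x7 x8 x9 = mat3 x1 (x6 + k * \<beta> * x9) (k * x5 + x8)
     (\<alpha> * x6 + p * x9) x2 (x4 + \<alpha> * k * x7) (p * x5 + \<alpha> * \<beta> * x8) (\<beta> * x4 + p * x7) x3"

text \<open>Right multiplication by \<open>gram\<close> carries the sandwich product to ordinary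
  matrix multiplication.\<close>

definition rep :: "'k \<Rightarrow> 'k \<Rightarrow> 'k \<Rightarrow> 'k \<Rightarrow> 'k \<Rightarrow> 'k \<Rightarrow> 'k \<Rightarrow> 'k \<Rightarrow> 'k \<Rightarrow> 'k^3^3" where
  "rep x1 x2 x3 x4 x5 x6 x7 x8 x9 = coeffs x1 x2 x3 x4 x5 x6 x7 x8 x9 ** gram"

lemma gram_mult_inv: "gram_det \<noteq> 0 \<Longrightarrow> gram ** gram_inv = mat 1"
  unfolding gram_inv_def mat_smult_mult_right
  by (rule mat3_eqI; simp add: matrix_mult_3_nth mat_smult_nth gram_def mat_def)
    (simp_all add: gram_det_def algebra_simps)

lemma gram_inv_mult: "gram_det \<noteq> 0 \<Longrightarrow> gram_inv ** gram = mat 1"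
  using gram_mult_inv by (simp add: matrix_left_right_inverse)

text \<open>The diagonal gives \<open>x1\<close>, \<open>x2\<close>, \<open>x3\<close>. Each pair of
  opposite entries off the diagonal is a linear system in two coefficients with determinant
  \<open>p - \<alpha> * \<beta> * k\<close> up to sign.\<close>

lemma coeffs_inject:
  assumes "p \<noteq> \<alpha> * \<beta> * k" "coeffs x1 x2 x3 x4 x5 x6 x7 x8 x9 = coeffs y1 y2 y3 y4 y5 y6 y7 y8 y9"
  shows "x1 = y1 \<and> x2 = y2 \<and> x3 = y3 \<and> x4 = y4 \<and> x5 = y5 \<and> x6 = y6 \<and> x7 = y7 \<and> x8 = y8 \<and> x9 = y9"
proof -
  note e = arg_cong[OF assms(2), of "\<lambda>M::'k^3^3. M $ i $ j" for i j, unfolded coeffs_def]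
  have d: "x1 = y1" "x2 = y2" "x3 = y3"
    using e[of 1 1] e[of 2 2] e[of 3 3] by simp_all
  have 23: "x4 + \<alpha> * k * x7 = y4 + \<alpha> * k * y7" "\<beta> * x4 + p * x7 = \<beta> * y4 + p * y7"
    using e[of 2 3] e[of 3 2] by simp_all
  have "(p - \<alpha> * \<beta> * k) * (x7 - y7) = 0" using 23 by algebra
  then have x7: "x7 = y7" using assms(1) by simp
  then have x4: "x4 = y4" using 23(1) by simp
  have 31: "p * x5 + \<alpha> * \<beta> * x8 = p * y5 + \<alpha> * \<beta> * y8" "k * x5 + x8 = k * y5 + y8"
    using e[of 3 1] e[of 1 3] by simp_all
  have "(p - \<alpha> * \<beta> * k) * (x5 - y5) = 0" using 31 by algebra
  then have x5: "x5 = y5" using assms(1) by simp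
  then have x8: "x8 = y8" using 31(2) by simp
  have 12: "x6 + k * \<beta> * x9 = y6 + k * \<beta> * y9" "\<alpha> * x6 + p * x9 = \<alpha> * y6 + p * y9"
    using e[of 1 2] e[of 2 1] by simp_all
  have "(p - \<alpha> * \<beta> * k) * (x9 - y9) = 0" using 12 by algebra
  then have x9: "x9 = y9" using assms(1) by simp
  then have x6: "x6 = y6" using 12(1) by simp
  show ?thesis using d x4 x5 x6 x7 x8 x9 by simp
qed

lemma rep_inject:
  assumes "p \<noteq> \<alpha> * \<beta> * k" "gram_det \<noteq> 0" "rep x1 x2 x3 x4 x5 x6 x7 x8 x9 = rep y1 y2 y3 y4 y5 y6
    y7 y8 y9"
  shows "x1 = y1 \<and> x2 = y2 \<and> x3 = y3 \<and> x4 = y4 \<and> x5 = y5 \<and> x6 = y6 \<and> x7 = y7 \<and> x8 = y8 \<and> x9 = y9"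
proof (rule coeffs_inject[OF assms(1)])
  show "coeffs x1 x2 x3 x4 x5 x6 x7 x8 x9 = coeffs y1 y2 y3 y4 y5 y6 y7 y8 y9"
    using arg_cong[OF assms(3), of "\<lambda>M. M ** gram_inv"] gram_mult_inv[OF assms(2)]
    by (simp add: rep_def flip: matrix_mul_assoc)
qed

text \<open>The same systems solved explicitly: Cramer's rule for \<open>x5\<close>,
  \<open>x7\<close>, \<open>x9\<close>, then substitution for the other three.\<close>

lemma coeffs_surj:
  fixes M :: "'k^3^3"
  assumes "p \<noteq> \<alpha> * \<beta> * k"
  defines "x5 \<equiv> (M $ 3 $ 1 - \<alpha> * \<beta> * M $ 1 $ 3) / (p - \<alpha> * \<beta> * k)"
    and "x7 \<equiv> (M $ 3 $ 2 - \<beta> * M $ 2 $ 3) / (p - \<alpha> * \<beta> * k)"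
    and "x9 \<equiv> (M $ 2 $ 1 - \<alpha> * M $ 1 $ 2) / (p - \<alpha> * \<beta> * k)"
  shows "coeffs (M $ 1 $ 1) (M $ 2 $ 2) (M $ 3 $ 3) (M $ 2 $ 3 - \<alpha> * k * x7) x5
     (M $ 1 $ 2 - k * \<beta> * x9) x7 (M $ 1 $ 3 - k * x5) x9 = M"
proof -
  have "(p - \<alpha> * \<beta> * k) * x5 = M $ 3 $ 1 - \<alpha> * \<beta> * M $ 1 $ 3"
    "(p - \<alpha> * \<beta> * k) * x7 = M $ 3 $ 2 - \<beta> * M $ 2 $ 3"
    "(p - \<alpha> * \<beta> * k) * x9 = M $ 2 $ 1 - \<alpha> * M $ 1 $ 2"
    using assms(1) by (simp_all add: x5_def x7_def x9_def)
  then show ?thesis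
    by (intro mat3_eqI) (simp_all add: coeffs_def algebra_simps)
qed

lemma rep_add: "rep x1 x2 x3 x4 x5 x6 x7 x8 x9 + rep y1 y2 y3 y4 y5 y6 y7 y8 y9 = rep (x1 + y1)
  (x2 + y2) (x3 + y3) (x4 + y4) (x5 + y5) (x6 + y6) (x7 + y7) (x8 + y8) (x9 + y9)"
  unfolding rep_def matrix_mult_add_left[symmetric]
  by (rule arg_cong[of _ _ "\<lambda>M. M ** gram"], rule mat3_eqI) (simp_all add: coeffs_def algebra_simps)

lemma rep_smult: "mat_smult c (rep x1 x2 x3 x4 x5 x6 x7 x8 x9) = rep (c * x1) (c * x2) (c * x3) (c
  * x4) (c * x5) (c * x6) (c * x7) (c * x8) (c * x9)"
  unfolding rep_def mat_smult_mult_left[symmetric]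
  by (rule arg_cong[of _ _ "\<lambda>M. M ** gram"], rule mat3_eqI)
    (simp_all add: coeffs_def mat_smult_nth algebra_simps)

text \<open>A common right factor \<open>gram\<close> is split off, so only an identity for the
  sandwich product has to be checked.\<close>

lemma rep_mult_add:
  assumes "coeffs x1 x2 x3 x4 x5 x6 x7 x8 x9 ** (gram ** coeffs y1 y2 y3 y4 y5 y6 y7 y8 y9) +
    coeffs y1 y2 y3 y4 y5 y6 y7 y8 y9 ** (gram ** coeffs x1 x2 x3 x4 x5 x6 x7 x8 x9) = coeffs z1
    z2 z3 z4 z5 z6 z7 z8 z9"
  shows "rep x1 x2 x3 x4 x5 x6 x7 x8 x9 ** rep y1 y2 y3 y4 y5 y6 y7 y8 y9 + rep y1 y2 y3 y4 y5 y6
    y7 y8 y9 ** rep x1 x2 x3 x4 x5 x6 x7 x8 x9 = rep z1 z2 z3 z4 z5 z6 z7 z8 z9"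
  unfolding rep_def assms[symmetric] by (simp only: matrix_mult_add_left matrix_mul_assoc)

section \<open>The table of \<open>comb_a\<close> to \<open>comb_w\<close> for matrices, with
  \<open>p * k\<close> for \<gamma> and \<open>p + \<alpha> * \<beta> * k\<close> for
  \<open>s\<close>\<close>

lemma rep_a: "rep x1 x2 x3 x4 x5 x6 x7 x8 x9 ** rep 1 0 0 0 0 0 0 0 0 + rep 1 0 0 0 0 0 0 0 0 **
  rep x1 x2 x3 x4 x5 x6 x7 x8 x9 =
   rep (2*x1 + 2*(p * k)*x5 + 2*\<alpha>*x6 + (p + \<alpha> * \<beta> * k)*x8 + (p + \<alpha> * \<beta> * k)*x9) (0) (0) (0)
     (x3+x5+\<alpha>*x7) (x2+x6+(p * k)*x7) (0) (x4+x8) (x4+x9)"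
  by (rule rep_mult_add, rule mat3_eqI; simp add: coeffs_def gram_def matrix_mult_3_nth; simp add:
    algebra_simps)

lemma rep_b: "rep x1 x2 x3 x4 x5 x6 x7 x8 x9 ** rep 0 1 0 0 0 0 0 0 0 + rep 0 1 0 0 0 0 0 0 0 **
  rep x1 x2 x3 x4 x5 x6 x7 x8 x9 =
   rep (0) (2*x2 + 2*\<alpha>*x6 + 2*\<beta>*x4 + (p + \<alpha> * \<beta> * k)*x9 + (p + \<alpha> * \<beta> * k)*x7) (0) (x3+x4+\<alpha>*x8) (0)
     (x1+x6+\<beta>*x8) (x5+x7) (0) (x5+x9)"
  by (rule rep_mult_add, rule mat3_eqI; simp add: coeffs_def gram_def matrix_mult_3_nth; simp add:
    algebra_simps)

lemma rep_c: "rep x1 x2 x3 x4 x5 x6 x7 x8 x9 ** rep 0 0 1 0 0 0 0 0 0 + rep 0 0 1 0 0 0 0 0 0 **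
  rep x1 x2 x3 x4 x5 x6 x7 x8 x9 =
   rep (0) (0) (2*x3 + 2*\<beta>*x4 + 2*(p * k)*x5 + (p + \<alpha> * \<beta> * k)*x7 + (p + \<alpha> * \<beta> * k)*x8) (x2+x4+(p
     * k)*x9) (x1+x5+\<beta>*x9) (0) (x6+x7) (x6+x8) (0)"
  by (rule rep_mult_add, rule mat3_eqI; simp add: coeffs_def gram_def matrix_mult_3_nth; simp add:
    algebra_simps)

lemma rep_f: "rep x1 x2 x3 x4 x5 x6 x7 x8 x9 ** rep 0 0 0 1 0 0 0 0 0 + rep 0 0 0 1 0 0 0 0 0 **
  rep x1 x2 x3 x4 x5 x6 x7 x8 x9 =
   rep (0) (2*\<beta>*x2+2*\<beta>*x4+(p + \<alpha> * \<beta> * k)*x6+(p + \<alpha> * \<beta> * k)*x7+2*(p * k)*\<beta>*x9) (2*\<beta>*x3+2*\<beta>*x4+(p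
     + \<alpha> * \<beta> * k)*x5+(p + \<alpha> * \<beta> * k)*x7+2*\<alpha>*\<beta>*x8) (x2+x3+2*\<beta>*x4+(p * k)*x5+\<alpha>*x6+(p + \<alpha> * \<beta> *
     k)*x8+(p + \<alpha> * \<beta> * k)*x9) (\<beta>*x5+\<beta>*x9) (\<beta>*x6+\<beta>*x8) (2*\<beta>*x7-\<beta>*x8-\<beta>*x9) (x1+x6+\<beta>*x8) (x1+x5+\<beta>*x9)"
  by (rule rep_mult_add, rule mat3_eqI; simp add: coeffs_def gram_def matrix_mult_3_nth; simp add:
    algebra_simps)

lemma rep_g: "rep x1 x2 x3 x4 x5 x6 x7 x8 x9 ** rep 0 0 0 0 1 0 0 0 0 + rep 0 0 0 0 1 0 0 0 0 **
  rep x1 x2 x3 x4 x5 x6 x7 x8 x9 =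
   rep (2*(p * k)*x1+2*(p * k)*x5+(p + \<alpha> * \<beta> * k)*x6+(p + \<alpha> * \<beta> * k)*x8+2*\<beta>*(p * k)*x9) (0) (2*(p
     * k)*x3+2*(p * k)*x5+(p + \<alpha> * \<beta> * k)*x4+(p + \<alpha> * \<beta> * k)*x8+2*\<alpha>*(p * k)*x7) ((p * k)*x4+(p *
     k)*x9) (x3+x1+2*(p * k)*x5+\<alpha>*x6+\<beta>*x4+(p + \<alpha> * \<beta> * k)*x9+(p + \<alpha> * \<beta> * k)*x7) ((p * k)*x6+(p *
     k)*x7) (x2+x6+(p * k)*x7) (2*(p * k)*x8-(p * k)*x9-(p * k)*x7) (x2+x4+(p * k)*x9)"
  by (rule rep_mult_add, rule mat3_eqI; simp add: coeffs_def gram_def matrix_mult_3_nth; simp add: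
    algebra_simps)

lemma rep_h: "rep x1 x2 x3 x4 x5 x6 x7 x8 x9 ** rep 0 0 0 0 0 1 0 0 0 + rep 0 0 0 0 0 1 0 0 0 **
  rep x1 x2 x3 x4 x5 x6 x7 x8 x9 =
   rep (2*\<alpha>*x1+2*\<alpha>*x6+(p + \<alpha> * \<beta> * k)*x5+(p + \<alpha> * \<beta> * k)*x9+2*\<beta>*\<alpha>*x8) (2*\<alpha>*x2+2*\<alpha>*x6+(p + \<alpha> * \<beta> *
     k)*x4+(p + \<alpha> * \<beta> * k)*x9+2*(p * k)*\<alpha>*x7) (0) (\<alpha>*x4+\<alpha>*x8) (\<alpha>*x5+\<alpha>*x7) (x1+x2+2*\<alpha>*x6+\<beta>*x4+(p *
     k)*x5+(p + \<alpha> * \<beta> * k)*x7+(p + \<alpha> * \<beta> * k)*x8) (x3+x5+\<alpha>*x7) (x3+x4+\<alpha>*x8) (2*\<alpha>*x9-\<alpha>*x7-\<alpha>*x8)"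
  by (rule rep_mult_add, rule mat3_eqI; simp add: coeffs_def gram_def matrix_mult_3_nth; simp add:
    algebra_simps)

lemma rep_u: "rep x1 x2 x3 x4 x5 x6 x7 x8 x9 ** rep 0 0 0 0 0 0 1 0 0 + rep 0 0 0 0 0 0 1 0 0 **
  rep x1 x2 x3 x4 x5 x6 x7 x8 x9 =
   rep (0) ((p + \<alpha> * \<beta> * k)*x2+(p + \<alpha> * \<beta> * k)*x4+2*\<alpha>*(p * k)*x6+2*\<alpha>*(p * k)*x7+(p * k)*(p + \<alpha> * \<beta>
     * k)*x9) ((p + \<alpha> * \<beta> * k)*x3+(p + \<alpha> * \<beta> * k)*x4+2*\<alpha>*(p * k)*x5+2*\<alpha>*(p * k)*x7+\<alpha>*(p + \<alpha> * \<beta> *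
     k)*x8) (\<alpha>*(p * k)*x8+\<alpha>*(p * k)*x9-2*\<alpha>*(p * k)*x7) (\<alpha>*x1+(p + \<alpha> * \<beta> * k)*x5+\<alpha>*x6+\<alpha>*\<beta>*x8+(p + \<alpha>
     * \<beta> * k)*x9) ((p * k)*x1+(p * k)*x5+(p + \<alpha> * \<beta> * k)*x6+(p + \<alpha> * \<beta> * k)*x8+(p * k)*\<beta>*x9)
     (x2+x3+2*\<beta>*x4+(p * k)*x5+\<alpha>*x6+2*(p + \<alpha> * \<beta> * k)*x7) (-(p * k)*x5-(p * k)*x9) (-\<alpha>*x6-\<alpha>*x8)"
  by (rule rep_mult_add, rule mat3_eqI; simp add: coeffs_def gram_def matrix_mult_3_nth; simp add:
    algebra_simps)

lemma rep_v: "rep x1 x2 x3 x4 x5 x6 x7 x8 x9 ** rep 0 0 0 0 0 0 0 1 0 + rep 0 0 0 0 0 0 0 1 0 **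
  rep x1 x2 x3 x4 x5 x6 x7 x8 x9 =
   rep ((p + \<alpha> * \<beta> * k)*x1+(p + \<alpha> * \<beta> * k)*x5+2*\<beta>*\<alpha>*x6+2*\<beta>*\<alpha>*x8+\<beta>*(p + \<alpha> * \<beta> * k)*x9) (0) ((p + \<alpha>
     * \<beta> * k)*x3+(p + \<alpha> * \<beta> * k)*x5+2*\<beta>*\<alpha>*x4+2*\<beta>*\<alpha>*x8+\<alpha>*(p + \<alpha> * \<beta> * k)*x7) (\<alpha>*x2+\<alpha>*x6+(p + \<alpha> * \<beta>
     * k)*x4+(p + \<alpha> * \<beta> * k)*x9+\<alpha>*(p * k)*x7) (\<beta>*\<alpha>*x9+\<beta>*\<alpha>*x7-2*\<beta>*\<alpha>*x8) (\<beta>*x2+(p + \<alpha> * \<beta> *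
     k)*x6+\<beta>*x4+\<beta>*(p * k)*x9+(p + \<alpha> * \<beta> * k)*x7) (-\<beta>*x4-\<beta>*x9) (x3+x1+2*(p * k)*x5+\<alpha>*x6+\<beta>*x4+2*(p +
     \<alpha> * \<beta> * k)*x8) (-\<alpha>*x6-\<alpha>*x7)"
  by (rule rep_mult_add, rule mat3_eqI; simp add: coeffs_def gram_def matrix_mult_3_nth; simp add:
    algebra_simps)

lemma rep_w: "rep x1 x2 x3 x4 x5 x6 x7 x8 x9 ** rep 0 0 0 0 0 0 0 0 1 + rep 0 0 0 0 0 0 0 0 1 **
  rep x1 x2 x3 x4 x5 x6 x7 x8 x9 =
   rep ((p + \<alpha> * \<beta> * k)*x1+(p + \<alpha> * \<beta> * k)*x6+2*(p * k)*\<beta>*x5+2*(p * k)*\<beta>*x9+\<beta>*(p + \<alpha> * \<beta> * k)*x8)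
     ((p + \<alpha> * \<beta> * k)*x2+(p + \<alpha> * \<beta> * k)*x6+2*(p * k)*\<beta>*x4+2*(p * k)*\<beta>*x9+(p * k)*(p + \<alpha> * \<beta> *
     k)*x7) (0) ((p * k)*x3+(p + \<alpha> * \<beta> * k)*x4+(p * k)*x5+(p * k)*\<alpha>*x7+(p + \<alpha> * \<beta> * k)*x8)
     (\<beta>*x3+\<beta>*x4+(p + \<alpha> * \<beta> * k)*x5+(p + \<alpha> * \<beta> * k)*x7+\<beta>*\<alpha>*x8) ((p * k)*\<beta>*x7+(p * k)*\<beta>*x8-2*(p *
     k)*\<beta>*x9) (-\<beta>*x4-\<beta>*x8) (-(p * k)*x5-(p * k)*x7) (x1+x2+2*\<alpha>*x6+\<beta>*x4+(p * k)*x5+2*(p + \<alpha> * \<beta> *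
     k)*x9)"
  by (rule rep_mult_add, rule mat3_eqI; simp add: coeffs_def gram_def matrix_mult_3_nth; simp add:
    algebra_simps)

end

section \<open>Quadratic extensions and hermitian matrices\<close>

locale embedded_field =
  fixes emb :: "'f::field \<Rightarrow> 'k::field"
  assumes field_embedding: "field_embedding emb"
begin

lemma emb_1: "emb 1 = 1" and emb_add: "emb (x + y) = emb x + emb y"
  and emb_mult: "emb (x * y) = emb x * emb y"
  using field_embedding by (simp_all add: field_embedding_def)

lemma emb_0: "emb 0 = 0"
proof -
  have "emb 0 + emb 0 = emb 0 + 0" using emb_add[of 0 0] by simp
  then show ?thesis by (rule add_left_imp_eq)
qed

lemma emb_minus: "emb (- x) = - emb x"
  using emb_add[of x "- x"] by (simp add: emb_0 eq_neg_iff_add_eq_0 add.commute)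

lemma emb_diff: "emb (x - y) = emb x - emb y"
  using emb_add[of x "- y"] by (simp add: emb_minus)

lemma emb_2: "emb 2 = 2"
  using emb_add[of 1 1] by (simp add: emb_1)

lemma emb_eq_0: "emb x = 0 \<longleftrightarrow> x = 0"
proof
  assume "emb x = 0"
  show "x = 0"
  proof (rule ccontr)
    assume "x \<noteq> 0"
    then have "emb x * emb (inverse x) = 1" by (simp add: emb_1 flip: emb_mult)
    with \<open>emb x = 0\<close> show False by simp
  qed
qed (simp add: emb_0)

lemma emb_eq: "emb x = emb y \<longleftrightarrow> x = y"
  using emb_eq_0[of "x - y"] by (simp add: emb_diff)

lemma emb_inverse: "emb (inverse x) = inverse (emb x)"
proof (cases "x = 0")
  case False
  then have "emb x * emb (inverse x) = 1" by (simp add: emb_1 flip: emb_mult)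
  then show ?thesis by (simp add: inverse_unique)
qed (simp add: emb_0)

lemma emb_divide: "emb (x / y) = emb x / emb y"
  by (simp add: divide_inverse emb_mult emb_inverse)

lemmas emb_simps = emb_0 emb_1 emb_2 emb_add emb_mult emb_minus emb_diff emb_divide

end

locale quadratic_extension = embedded_field emb
  for emb :: "'f::field \<Rightarrow> 'k::field" +
  fixes z d
  assumes square: "z\<^sup>2 = emb d" and not_square: "\<not> (\<exists>s. d = s\<^sup>2)"
begin

lemma zz: "z * (z * x) = emb d * x"
  using square by (simp add: power2_eq_square flip: mult.assoc)

lemma z_notin: "z \<noteq> emb x"
proof
  assume "z = emb x"
  then have "emb d = emb (x\<^sup>2)" using square by (simp add: power2_eq_square emb_mult)
  then show False using not_square emb_eq by blast
qed

lemma eq_0_iff: "emb x + z * emb y = 0 \<longleftrightarrow> x = 0 \<and> y = 0"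
proof
  assume *: "emb x + z * emb y = 0"
  show "x = 0 \<and> y = 0"
  proof (cases "y = 0")
    case False
    have "z * emb y = - emb x" using * by (simp add: eq_neg_iff_add_eq_0 add.commute)
    then have "z = - emb x / emb y" using False emb_eq_0[of y] by (simp add: field_simps)
    then have "z = emb (- x / y)" by (simp add: emb_simps)
    with z_notin show ?thesis by blast
  qed (use * in \<open>simp add: emb_0 emb_eq_0\<close>)
qed (simp add: emb_0)

lemma eq_iff: "emb x + z * emb y = emb x' + z * emb y' \<longleftrightarrow> x = x' \<and> y = y'"
  using eq_0_iff[of "x - x'" "y - y'"] by (simp add: emb_diff algebra_simps)

text \<open>The norm form is anisotropic, as a zero with \<open>y \<noteq> 0\<close> would make
  \<open>d\<close> the square of \<open>x / y\<close>.\<close>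

lemma norm_eq_0: "x * x - d * (y * y) = 0 \<longleftrightarrow> x = 0 \<and> y = 0"
proof
  assume *: "x * x - d * (y * y) = 0"
  show "x = 0 \<and> y = 0"
  proof (cases "y = 0")
    case False
    then have "d = (x / y)\<^sup>2" using * by (simp add: power2_eq_square field_simps)
    with not_square show ?thesis by blast
  qed (use * in simp)
qed simp

text \<open>Multiply by the conjugate and divide by the norm. At zero both sides are 0 by the
  convention for division by zero.\<close>

lemma inverse_eq:
  "inverse (emb x + z * emb y) =
     emb (x / (x * x - d * (y * y))) + z * emb (- y / (x * x - d * (y * y)))"
proof (cases "x = 0 \<and> y = 0")
  case False
  let ?n = "x * x - d * (y * y)"
  have n: "emb ?n \<noteq> 0" using False norm_eq_0 emb_eq_0 by simp
  have "(emb x + z * emb y) * (emb x - z * emb y) = emb ?n"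
    by (simp add: emb_simps algebra_simps zz)
  then have "(emb x + z * emb y) * ((emb x - z * emb y) / emb ?n) = 1"
    using n by simp
  then have "inverse (emb x + z * emb y) = (emb x - z * emb y) / emb ?n"
    by (rule inverse_unique)
  then show ?thesis by (simp add: emb_divide[of _ ?n] emb_minus diff_divide_distrib)
qed (auto simp: emb_simps)

lemma adjoin_eq: "adjoin emb z = {emb x + z * emb y | x y. True}" (is "_ = ?P")
proof
  have "is_subfield ?P"
    unfolding is_subfield_def
  proof (intro conjI ballI)
    have "0 = emb 0 + z * emb 0" "1 = emb 1 + z * emb 0" by (simp_all add: emb_simps)
    then show "0 \<in> ?P" "1 \<in> ?P" by blast+
    fix q assume "q \<in> ?P"
    then obtain x y where q: "q = emb x + z * emb y" by blast
    show "inverse q \<in> ?P" unfolding q inverse_eq by blast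
    fix r assume "r \<in> ?P"
    then obtain x' y' where r: "r = emb x' + z * emb y'" by blast
    have "q - r = emb (x - x') + z * emb (y - y')"
      by (simp add: q r emb_simps algebra_simps)
    then show "q - r \<in> ?P" by blast
    have "q * r = emb (x * x' + d * (y * y')) + z * emb (x * y' + y * x')"
      by (simp add: q r emb_simps algebra_simps zz)
    then show "q * r \<in> ?P" by blast
  qed
  moreover have "range emb \<subseteq> ?P"
  proof
    fix q assume "q \<in> range emb"
    then obtain x where "q = emb x + z * emb 0" by (auto simp: emb_0)
    then show "q \<in> ?P" by blast
  qed
  moreover have "z = emb 0 + z * emb 1" by (simp add: emb_simps)
  then have "z \<in> ?P" by blast
  ultimately show "adjoin emb z \<subseteq> ?P" unfolding adjoin_def by blast
  show "?P \<subseteq> adjoin emb z"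
    unfolding adjoin_def
  proof (intro Inter_greatest subsetI)
    fix S q
    assume "S \<in> {S. is_subfield S \<and> range emb \<subseteq> S \<and> z \<in> S}" and "q \<in> ?P"
    then have S: "is_subfield S" "\<And>x. emb x \<in> S" "z \<in> S" by auto
    obtain x y where q: "q = emb x + z * emb y" using \<open>q \<in> ?P\<close> by blast
    \<comment> \<open>\<open>is_subfield\<close> provides closure under subtraction, so the sum is
      written as a double difference.\<close>
    have "q = emb x - (emb 0 - z * emb y)" by (simp add: q emb_0)
    then show "q \<in> S" using S unfolding is_subfield_def by simp
  qed
qed

lemma adjoinE:
  assumes "q \<in> adjoin emb z"
  obtains x y where "q = emb x + z * emb y"
  using assms unfolding adjoin_eq by blast

text \<open>The description by \<open>THE\<close> is unique because the coordinates with respect to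
  1 and \<open>z\<close> are unique.\<close>

lemma conj_ext_eq: "conj_ext emb z (emb x + z * emb y) = emb x - z * emb y"
  unfolding conj_ext_def by (rule the_equality) (auto simp: eq_iff)

end

text \<open>Abstracts a subfield with an involutive automorphism, so that the calculations with
  conjugate transposes need no coordinates with respect to 1 and \<open>z\<close>.\<close>

locale field_involution =
  fixes P :: "'k::field set" and c :: "'k \<Rightarrow> 'k"
  assumes zero_mem: "0 \<in> P" and one_mem: "1 \<in> P"
    and diff_mem: "x \<in> P \<Longrightarrow> y \<in> P \<Longrightarrow> x - y \<in> P"
    and mult_mem: "x \<in> P \<Longrightarrow> y \<in> P \<Longrightarrow> x * y \<in> P"
    and inverse_mem: "x \<in> P \<Longrightarrow> inverse x \<in> P"
    and c_mem: "x \<in> P \<Longrightarrow> c x \<in> P"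
    and c_add: "x \<in> P \<Longrightarrow> y \<in> P \<Longrightarrow> c (x + y) = c x + c y"
    and c_mult: "x \<in> P \<Longrightarrow> y \<in> P \<Longrightarrow> c (x * y) = c x * c y"
    and c_c: "x \<in> P \<Longrightarrow> c (c x) = x"
begin

lemma add_mem: "x \<in> P \<Longrightarrow> y \<in> P \<Longrightarrow> x + y \<in> P"
  using diff_mem[of x "0 - y"] diff_mem[of 0 y] zero_mem by simp

lemma divide_mem: "x \<in> P \<Longrightarrow> y \<in> P \<Longrightarrow> x / y \<in> P"
  by (simp add: divide_inverse mult_mem inverse_mem)

lemmas mem = zero_mem one_mem diff_mem add_mem mult_mem divide_mem

lemma c_0: "c 0 = 0"
proof -
  have "c 0 + c 0 = c 0 + 0" using c_add[OF zero_mem zero_mem] by simp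
  then show ?thesis by (rule add_left_imp_eq)
qed

lemma c_1: "c 1 = 1"
  using c_mult[OF one_mem c_mem[OF one_mem]] c_c[OF one_mem] by simp

definition ct :: "'k^3^3 \<Rightarrow> 'k^3^3" where
  "ct X = transpose (map_matrix c X)"

lemma ct_nth: "ct X $ i $ j = c (X $ j $ i)"
  by (simp add: ct_def transpose_def map_matrix_def)

lemma matrices_over_nth: "X \<in> matrices_over P \<Longrightarrow> X $ i $ j \<in> P"
  by (simp add: matrices_over_def)

lemma mult_matrices_over:
  fixes X Y :: "'k^3^3"
  shows "X \<in> matrices_over P \<Longrightarrow> Y \<in> matrices_over P \<Longrightarrow> X ** Y \<in> matrices_over P"
  by (simp add: matrices_over_def matrix_mult_3_nth mem)

lemma ct_matrices_over: "X \<in> matrices_over P \<Longrightarrow> ct X \<in> matrices_over P"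
  by (simp add: matrices_over_def ct_nth c_mem)

lemma ct_add:
  "X \<in> matrices_over P \<Longrightarrow> Y \<in> matrices_over P \<Longrightarrow> ct (X + Y) = ct X + ct Y"
  by (simp add: vec_eq_iff ct_nth c_add matrices_over_nth)

lemma ct_mult:
  "X \<in> matrices_over P \<Longrightarrow> Y \<in> matrices_over P \<Longrightarrow> ct (X ** Y) = ct Y ** ct X"
  by (simp add: vec_eq_iff ct_nth matrix_mult_3_nth c_add c_mult matrices_over_nth mem mult.commute)

lemma ct_ct: "X \<in> matrices_over P \<Longrightarrow> ct (ct X) = X"
  by (simp add: vec_eq_iff ct_nth c_c matrices_over_nth)

lemma ct_smult: "s \<in> P \<Longrightarrow> X \<in> matrices_over P \<Longrightarrow> ct (mat_smult s X) = mat_smult (c s) (ct X)"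
  by (simp add: vec_eq_iff ct_nth mat_smult_nth c_mult matrices_over_nth)

lemma ct_one: "ct (mat 1) = mat 1"
  by (simp add: vec_eq_iff ct_nth mat_def c_0 c_1)

end

lemma mat3_matrices_over:
  "mat3 m11 m12 m13 m21 m22 m23 m31 m32 m33 \<in> matrices_over P \<longleftrightarrow>
     m11 \<in> P \<and> m12 \<in> P \<and> m13 \<in> P \<and> m21 \<in> P \<and> m22 \<in> P \<and> m23 \<in> P \<and> m31 \<in> P \<and> m32 \<in> P \<and> m33 \<in> P"
  by (auto simp: matrices_over_def forall_3)

text \<open>The essential assumption is that \<open>c\<close> exchanges the two roots
  \<open>p\<close> and \<open>\<alpha> * \<beta> * k\<close> while fixing \<alpha> and
  \<beta>.\<close>

locale hermitian_munn = munn \<alpha> \<beta> p k + field_involution P c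
  for \<alpha> \<beta> p k :: "'k::field" and P :: "'k set" and c +
  assumes mem_P: "\<alpha> \<in> P" "\<beta> \<in> P" "p \<in> P" "k \<in> P"
    and c_fix: "c \<alpha> = \<alpha>" "c \<beta> = \<beta>" and nonzero: "\<alpha> \<noteq> 0" "\<beta> \<noteq> 0"
    and c_p: "c p = \<alpha> * \<beta> * k" and c_k: "\<alpha> * \<beta> * c k = p"
    and p_neq: "p \<noteq> \<alpha> * \<beta> * k" and det_neq_0: "gram_det \<noteq> 0"
begin

text \<open>Scaling the rows of the Gram matrix makes it hermitian.\<close>

definition row_scale :: "'k^3^3" where
  "row_scale = mat3 (\<alpha> * \<beta>) 0 0 0 \<beta> 0 0 0 1"

definition T :: "'k^3^3" where
  "T = row_scale ** gram"

definition T_inv :: "'k^3^3" where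
  "T_inv = gram_inv ** mat3 (1 / (\<alpha> * \<beta>)) 0 0 0 (1 / \<beta>) 0 0 0 1"

lemma gram_matrices_over: "gram \<in> matrices_over P" "gram_inv \<in> matrices_over P"
  "row_scale \<in> matrices_over P"
proof -
  have "gram_det \<in> P" by (simp add: gram_det_def mem mem_P)
  then show "gram_inv \<in> matrices_over P"
    unfolding gram_inv_def by (simp add: matrices_over_def mat_smult_nth forall_3 mem mem_P)
qed (simp_all add: gram_def row_scale_def mat3_matrices_over mem mem_P)

lemma T_matrices_over: "T \<in> matrices_over P"
  by (simp add: T_def mult_matrices_over gram_matrices_over)

lemma T_inv_matrices_over: "T_inv \<in> matrices_over P"
  by (simp add: T_inv_def mult_matrices_over gram_matrices_over mat3_matrices_over mem mem_P)

lemma T_mult_T_inv: "T ** T_inv = mat 1"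
proof -
  have "T ** T_inv = row_scale ** (gram ** gram_inv) ** mat3 (1 / (\<alpha> * \<beta>)) 0 0 0 (1 / \<beta>) 0 0 0 1"
    by (simp only: T_def T_inv_def matrix_mul_assoc)
  also have "\<dots> = mat 1"
    by (rule mat3_eqI; simp add: gram_mult_inv[OF det_neq_0] row_scale_def matrix_mult_3_nth
      mat_def nonzero)
  finally show ?thesis .
qed

lemma T_inv_mult_T: "T_inv ** T = mat 1"
  using T_mult_T_inv by (simp add: matrix_left_right_inverse)

lemma invertible_T: "invertible T"
  unfolding invertible_def using T_mult_T_inv T_inv_mult_T by blast

text \<open>\<open>matrix_inv\<close> is given by a choice; the explicit inverse shows that the
  choice succeeds and determines its value.\<close>

lemma matrix_inv_T: "matrix_inv T = T_inv"
proof -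
  have "\<exists>S. T ** S = mat 1 \<and> S ** T = mat 1"
    using T_mult_T_inv T_inv_mult_T by blast
  then have "T ** matrix_inv T = mat 1 \<and> matrix_inv T ** T = mat 1"
    unfolding matrix_inv_def by (rule someI_ex)
  then have "T_inv ** (T ** matrix_inv T) = T_inv" by simp
  then show ?thesis by (simp add: matrix_mul_assoc T_inv_mult_T)
qed

lemma ct_T: "ct T = T"
  by (rule mat3_eqI; simp add: ct_nth T_def row_scale_def gram_def matrix_mult_3_nth)
    (simp_all add: c_0 c_1 c_fix c_p c_mult mem_P mem mult.assoc c_k[unfolded mult.assoc])

lemma ct_T_inv: "ct T_inv = T_inv"
proof -
  have "T ** ct T_inv = ct (T_inv ** T)"
    by (simp add: ct_mult T_matrices_over T_inv_matrices_over ct_T)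
  then have "T_inv ** (T ** ct T_inv) = T_inv" by (simp add: T_inv_mult_T ct_one)
  then show ?thesis by (simp add: matrix_mul_assoc T_inv_mult_T)
qed

definition j :: "'k^3^3 \<Rightarrow> 'k^3^3" where
  "j X = T_inv ** ct X ** T"

text \<open>As \<open>T\<close> is hermitian, the scalar \<open>t\<close> of the theorem can be
  taken to be 1.\<close>

lemma j_T: "j T = T"
  by (simp add: j_def ct_T T_inv_mult_T)

text \<open>The map \<open>e\<close> stands for the embedding of the base field, whose image is
  fixed by \<open>c\<close>; this makes the semilinear map \<open>j\<close> linear over the base
  field. Since \<open>T\<close> and its inverse are hermitian, their factors cancel in
  \<open>j (j X)\<close>.\<close>

lemma is_involution_j:
  assumes "\<And>r. e r \<in> P" "\<And>r. c (e r) = e r"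
  shows "is_involution (matrices_over P) (\<lambda>r. mat_smult (e r)) (**) j"
  unfolding is_involution_def
proof (intro conjI ballI allI)
  fix X :: "'k^3^3" assume X: "X \<in> matrices_over P"
  show "j X \<in> matrices_over P"
    by (simp add: j_def mult_matrices_over ct_matrices_over X T_matrices_over T_inv_matrices_over)
  show "j (mat_smult (e r) X) = mat_smult (e r) (j X)" for r
    by (simp add: j_def ct_smult assms X mat_smult_mult_left mat_smult_mult_right)
  have "j (j X) = T_inv ** (T ** (X ** T_inv)) ** T"
    by (simp add: j_def ct_mult mult_matrices_over ct_matrices_over X T_matrices_over
        T_inv_matrices_over ct_T ct_T_inv ct_ct)
  also have "\<dots> = (T_inv ** T) ** X ** (T_inv ** T)" by (simp only: matrix_mul_assoc)
  finally show "j (j X) = X" by (simp add: T_inv_mult_T)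
  fix Y :: "'k^3^3" assume Y: "Y \<in> matrices_over P"
  show "j (X + Y) = j X + j Y"
    by (simp add: j_def ct_add X Y matrix_add_ldistrib matrix_mult_add_left)
  have "j Y ** j X = T_inv ** ct Y ** (T ** T_inv) ** ct X ** T"
    by (simp only: j_def matrix_mul_assoc)
  then show "j (X ** Y) = j Y ** j X"
    by (simp add: j_def ct_mult X Y T_mult_T_inv matrix_mul_assoc)
qed

lemma coeffs_matrices_over:
  assumes "{x1, x2, x3, x4, x5, x6, x7, x8, x9} \<subseteq> P"
  shows "coeffs x1 x2 x3 x4 x5 x6 x7 x8 x9 \<in> matrices_over P"
  using assms by (simp add: coeffs_def mat3_matrices_over mem mem_P)

text \<open>The involution acts on the coefficients by \<open>c\<close>. Consequently its fixed
  points are the combinations with coefficients fixed by \<open>c\<close>.\<close>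

lemma j_rep:
  assumes "{x1, x2, x3, x4, x5, x6, x7, x8, x9} \<subseteq> P"
  shows "j (rep x1 x2 x3 x4 x5 x6 x7 x8 x9) = rep (c x1) (c x2) (c x3) (c x4) (c x5) (c x6) (c x7)
    (c x8) (c x9)"
proof -
  let ?M = "coeffs x1 x2 x3 x4 x5 x6 x7 x8 x9" and ?N = "coeffs (c x1) (c x2) (c x3) (c x4) (c x5)
    (c x6) (c x7) (c x8) (c x9)"
  have M: "?M \<in> matrices_over P" by (rule coeffs_matrices_over[OF assms])
  \<comment> \<open>Transposition swaps opposite entries, \<open>c\<close> swaps the two roots, and
    the row scaling compensates for the remaining factors \<alpha> and \<beta>.\<close>
  have 1: "ct ?M ** row_scale = row_scale ** ?N"
    using assms
    by (intro mat3_eqI; simp add: ct_nth coeffs_def row_scale_def matrix_mult_3_nth)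
      ((simp add: c_add c_mult c_fix c_p mem mem_P; simp add: algebra_simps flip: c_k)+)
  have "ct row_scale = row_scale"
    by (rule mat3_eqI; simp add: ct_nth row_scale_def c_0 c_1 c_mult c_fix mem_P)
  then have 2: "T = ct gram ** row_scale"
    using ct_T unfolding T_def by (simp add: ct_mult gram_matrices_over)
  have "j (rep x1 x2 x3 x4 x5 x6 x7 x8 x9) = T_inv ** (ct gram ** ct ?M) ** (row_scale ** gram)"
    by (simp add: j_def rep_def ct_mult gram_matrices_over M flip: T_def)
  also have "\<dots> = T_inv ** ct gram ** (ct ?M ** row_scale) ** gram"
    by (simp only: matrix_mul_assoc)
  also have "\<dots> = (T_inv ** (ct gram ** row_scale)) ** ?N ** gram"
    by (simp only: 1 matrix_mul_assoc)
  also have "\<dots> = rep (c x1) (c x2) (c x3) (c x4) (c x5) (c x6) (c x7) (c x8) (c x9)"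
    by (simp add: 2[symmetric] T_inv_mult_T rep_def)
  finally show ?thesis .
qed

text \<open>The coefficients in \<open>coeffs_surj\<close> arise by field operations and so stay in
  \<open>P\<close>.\<close>

lemma rep_surj:
  assumes X: "Z \<in> matrices_over P"
  obtains x1 x2 x3 x4 x5 x6 x7 x8 x9 where "{x1, x2, x3, x4, x5, x6, x7, x8, x9} \<subseteq> P" "Z = rep x1
    x2 x3 x4 x5 x6 x7 x8 x9"
proof -
  define M where "M = Z ** gram_inv"
  have M: "M $ i $ l \<in> P" for i l
    unfolding M_def by (intro matrices_over_nth mult_matrices_over X gram_matrices_over)
  have "Z = M ** gram"
    by (simp add: M_def gram_inv_mult[OF det_neq_0] flip: matrix_mul_assoc)
  note * = trans[OF this arg_cong[OF coeffs_surj[OF p_neq, of M, symmetric], of "\<lambda>N. N ** gram"],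
      folded rep_def]
  show ?thesis
    by (rule that[OF _ *]) (intro insert_subsetI empty_subsetI mem M mem_P)
qed

end

section \<open>Isomorphisms\<close>

lemma mat_smult_add: "mat_smult r (X + Y) = mat_smult r X + mat_smult r Y"
  for X Y :: "'k::comm_semiring_1^3^3"
  by (rule mat3_eqI; simp add: mat_smult_nth algebra_simps)

text \<open>The nine elements and their matrices satisfy the same table. Sending a combination to
  the matrix with the embedded coefficients is well defined by independence and injective by
  \<open>rep_inject\<close>.\<close>

lemma (in axis_triple_psi) algebra_isomorphic_rep:
  fixes emb :: "'f \<Rightarrow> 'k::field" and p k :: 'k
  assumes gen: "generated_by {a, b, c}" and dim: "dim (UNIV :: 'a set) = 9"
    and emb: "field_embedding emb"
    and params: "emb \<gamma> = p * k" "emb s = p + emb \<alpha> * emb \<beta> * k"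
    and p_neq: "p \<noteq> emb \<alpha> * emb \<beta> * k"
    and det: "munn.gram_det (emb \<alpha>) (emb \<beta>) p k \<noteq> 0"
  shows "algebra_isomorphic UNIV scale mult
    {Z. \<exists>x1 x2 x3 x4 x5 x6 x7 x8 x9. Z = munn.rep (emb \<alpha>) (emb \<beta>) p k (emb x1) (emb x2) (emb x3)
      (emb x4) (emb x5) (emb x6) (emb x7) (emb x8) (emb x9)}
    (\<lambda>r. mat_smult (emb r)) jordan_product"
proof -
  interpret E: embedded_field emb by unfold_locales (rule emb)
  interpret R: munn "emb \<alpha>" "emb \<beta>" p k .
  define H where "H x1 x2 x3 x4 x5 x6 x7 x8 x9 = R.rep (emb x1) (emb x2) (emb x3) (emb x4) (emb
    x5) (emb x6) (emb x7) (emb x8) (emb x9)" for x1 x2 x3 x4 x5 x6 x7 x8 x9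
  \<comment> \<open>Coordinates indexed by numbers, so that one choice function supplies all
    nine.\<close>
  have "\<exists>\<kappa>. x = comb (\<kappa> 0) (\<kappa> 1) (\<kappa> 2) (\<kappa> 3) (\<kappa> 4) (\<kappa> 5) (\<kappa> 6) (\<kappa> 7) (\<kappa> (8::nat))" for x
  proof -
    obtain x1 x2 x3 x4 x5 x6 x7 x8 x9 where x: "x = comb x1 x2 x3 x4 x5 x6 x7 x8 x9" by (rule
      comb_spans[OF gen])
    show ?thesis
      by (rule exI[of _ "\<lambda>i. [x1, x2, x3, x4, x5, x6, x7, x8, x9] ! i"]) (simp add: x)
  qed
  then obtain \<kappa> :: "'a \<Rightarrow> nat \<Rightarrow> 'f" where \<kappa>: "\<And>x. x = comb (\<kappa> x 0) (\<kappa> x 1) (\<kappa> x 2) (\<kappa> x 3) (\<kappa> x 4)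
    (\<kappa> x 5) (\<kappa> x 6) (\<kappa> x 7) (\<kappa> x 8)"
    by metis
  define \<phi> where "\<phi> x = H (\<kappa> x 0) (\<kappa> x 1) (\<kappa> x 2) (\<kappa> x 3) (\<kappa> x 4) (\<kappa> x 5) (\<kappa> x 6) (\<kappa> x 7) (\<kappa> x 8)"
    for x
  have h_comb: "\<phi> (comb x1 x2 x3 x4 x5 x6 x7 x8 x9) = H x1 x2 x3 x4 x5 x6 x7 x8 x9" for x1 x2 x3
    x4 x5 x6 x7 x8 x9
    using comb_inject[OF gen dim \<kappa>[of "comb x1 x2 x3 x4 x5 x6 x7 x8 x9"]] unfolding \<phi>_def by (elim
      conjE) (simp only:)
  have h_add: "\<phi> (x + y) = \<phi> x + \<phi> y" for x y
  proof -
    obtain x1 x2 x3 x4 x5 x6 x7 x8 x9 where x: "x = comb x1 x2 x3 x4 x5 x6 x7 x8 x9" by (rule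
      comb_spans[OF gen])
    obtain y1 y2 y3 y4 y5 y6 y7 y8 y9 where y: "y = comb y1 y2 y3 y4 y5 y6 y7 y8 y9" by (rule
      comb_spans[OF gen])
    show ?thesis unfolding x y comb_add h_comb H_def R.rep_add E.emb_add ..
  qed
  have h_scale: "\<phi> (scale r x) = mat_smult (emb r) (\<phi> x)" for r x
  proof -
    obtain x1 x2 x3 x4 x5 x6 x7 x8 x9 where x: "x = comb x1 x2 x3 x4 x5 x6 x7 x8 x9" by (rule
      comb_spans[OF gen])
    show ?thesis unfolding x comb_scale h_comb H_def R.rep_smult E.emb_mult ..
  qed
  have h_basis: "\<phi> a = R.rep 1 0 0 0 0 0 0 0 0" "\<phi> b = R.rep 0 1 0 0 0 0 0 0 0"
    "\<phi> c = R.rep 0 0 1 0 0 0 0 0 0" "\<phi> f = R.rep 0 0 0 1 0 0 0 0 0"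
    "\<phi> g = R.rep 0 0 0 0 1 0 0 0 0" "\<phi> (jp a b) = R.rep 0 0 0 0 0 1 0 0 0"
    "\<phi> u = R.rep 0 0 0 0 0 0 1 0 0" "\<phi> v = R.rep 0 0 0 0 0 0 0 1 0"
    "\<phi> w = R.rep 0 0 0 0 0 0 0 0 1"
    by (subst mem_comb, unfold h_comb H_def E.emb_simps, rule refl)+
  \<comment> \<open>Compatibility with the product is linear in the second argument, so it need only
    be checked when \<open>y\<close> is one of the nine elements.\<close>
  define Q where "Q x y \<longleftrightarrow> \<phi> (jp x y) = \<phi> x ** \<phi> y + \<phi> y ** \<phi> x" for x y
  have Q_a: "Q x a" for x
  proof -
    obtain x1 x2 x3 x4 x5 x6 x7 x8 x9 where x: "x = comb x1 x2 x3 x4 x5 x6 x7 x8 x9" by (rule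
      comb_spans[OF gen])
    show ?thesis
      unfolding Q_def x comb_a h_comb H_def h_basis R.rep_a E.emb_simps params
      by (simp add: algebra_simps)
  qed
  have Q_b: "Q x b" for x
  proof -
    obtain x1 x2 x3 x4 x5 x6 x7 x8 x9 where x: "x = comb x1 x2 x3 x4 x5 x6 x7 x8 x9" by (rule
      comb_spans[OF gen])
    show ?thesis
      unfolding Q_def x comb_b h_comb H_def h_basis R.rep_b E.emb_simps params
      by (simp add: algebra_simps)
  qed
  have Q_c: "Q x c" for x
  proof -
    obtain x1 x2 x3 x4 x5 x6 x7 x8 x9 where x: "x = comb x1 x2 x3 x4 x5 x6 x7 x8 x9" by (rule
      comb_spans[OF gen])
    show ?thesis
      unfolding Q_def x comb_c h_comb H_def h_basis R.rep_c E.emb_simps params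
      by (simp add: algebra_simps)
  qed
  have Q_f: "Q x f" for x
  proof -
    obtain x1 x2 x3 x4 x5 x6 x7 x8 x9 where x: "x = comb x1 x2 x3 x4 x5 x6 x7 x8 x9" by (rule
      comb_spans[OF gen])
    show ?thesis
      unfolding Q_def x comb_f h_comb H_def h_basis R.rep_f E.emb_simps params
      by (simp add: algebra_simps)
  qed
  have Q_g: "Q x g" for x
  proof -
    obtain x1 x2 x3 x4 x5 x6 x7 x8 x9 where x: "x = comb x1 x2 x3 x4 x5 x6 x7 x8 x9" by (rule
      comb_spans[OF gen])
    show ?thesis
      unfolding Q_def x comb_g h_comb H_def h_basis R.rep_g E.emb_simps params
      by (simp add: algebra_simps)
  qed
  have Q_h: "Q x h" for x
  proof -
    obtain x1 x2 x3 x4 x5 x6 x7 x8 x9 where x: "x = comb x1 x2 x3 x4 x5 x6 x7 x8 x9" by (rule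
      comb_spans[OF gen])
    show ?thesis
      unfolding Q_def x comb_h h_comb H_def h_basis R.rep_h E.emb_simps params
      by (simp add: algebra_simps)
  qed
  have Q_u: "Q x u" for x
  proof -
    obtain x1 x2 x3 x4 x5 x6 x7 x8 x9 where x: "x = comb x1 x2 x3 x4 x5 x6 x7 x8 x9" by (rule
      comb_spans[OF gen])
    show ?thesis
      unfolding Q_def x comb_u h_comb H_def h_basis R.rep_u E.emb_simps params
      by (simp add: algebra_simps)
  qed
  have Q_v: "Q x v" for x
  proof -
    obtain x1 x2 x3 x4 x5 x6 x7 x8 x9 where x: "x = comb x1 x2 x3 x4 x5 x6 x7 x8 x9" by (rule
      comb_spans[OF gen])
    show ?thesis
      unfolding Q_def x comb_v h_comb H_def h_basis R.rep_v E.emb_simps params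
      by (simp add: algebra_simps)
  qed
  have Q_w: "Q x w" for x
  proof -
    obtain x1 x2 x3 x4 x5 x6 x7 x8 x9 where x: "x = comb x1 x2 x3 x4 x5 x6 x7 x8 x9" by (rule
      comb_spans[OF gen])
    show ?thesis
      unfolding Q_def x comb_w h_comb H_def h_basis R.rep_w E.emb_simps params
      by (simp add: algebra_simps)
  qed
  have Q_add: "Q x (y + z)" if "Q x y" "Q x z" for x y z
    using that unfolding Q_def jp_add_right h_add
    by (simp add: matrix_add_ldistrib matrix_mult_add_left ac_simps)
  have Q_scale: "Q x (scale r y)" if "Q x y" for x y r
    using that unfolding Q_def jp_scale_right h_scale
    by (simp add: mat_smult_mult_left mat_smult_mult_right mat_smult_add)
  have h_jp: "\<phi> (jp x y) = \<phi> x ** \<phi> y + \<phi> y ** \<phi> x" for x y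
  proof -
    obtain y1 y2 y3 y4 y5 y6 y7 y8 y9 where y: "y = comb y1 y2 y3 y4 y5 y6 y7 y8 y9" by (rule
      comb_spans[OF gen])
    have "Q x y"
      unfolding y comb_def
      by (intro Q_add Q_scale Q_a Q_b Q_c Q_f Q_g Q_h Q_u Q_v Q_w)
    then show ?thesis by (simp only: Q_def)
  qed
  have h_mult: "\<phi> (mult x y) = jordan_product (\<phi> x) (\<phi> y)" for x y
    unfolding mult_jp h_scale h_jp jordan_product_def by (simp add: E.emb_simps)
  have "bij_betw \<phi> UNIV {Z. \<exists>x1 x2 x3 x4 x5 x6 x7 x8 x9. Z = R.rep (emb x1) (emb x2) (emb x3) (emb
    x4) (emb x5) (emb x6) (emb x7) (emb x8) (emb x9)}"
    unfolding bij_betw_def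
  proof
    show "inj \<phi>"
    proof (rule injI)
      fix x y assume xy: "\<phi> x = \<phi> y"
      obtain x1 x2 x3 x4 x5 x6 x7 x8 x9 where x: "x = comb x1 x2 x3 x4 x5 x6 x7 x8 x9" by (rule
        comb_spans[OF gen])
      obtain y1 y2 y3 y4 y5 y6 y7 y8 y9 where y: "y = comb y1 y2 y3 y4 y5 y6 y7 y8 y9" by (rule
        comb_spans[OF gen])
      show "x = y"
        using R.rep_inject[OF p_neq det xy[unfolded x y h_comb H_def]]
        unfolding x y E.emb_eq by (elim conjE) (simp only:)
    qed
    show "range \<phi> = {Z. \<exists>x1 x2 x3 x4 x5 x6 x7 x8 x9. Z = R.rep (emb x1) (emb x2) (emb x3) (emb x4)
      (emb x5) (emb x6) (emb x7) (emb x8) (emb x9)}"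
    proof (intro equalityI subsetI)
      fix Z assume "Z \<in> range \<phi>"
      then obtain x where "Z = \<phi> x" by blast
      then show "Z \<in> {Z. \<exists>x1 x2 x3 x4 x5 x6 x7 x8 x9. Z = R.rep (emb x1) (emb x2) (emb x3) (emb
        x4) (emb x5) (emb x6) (emb x7) (emb x8) (emb x9)}"
        unfolding \<phi>_def H_def by (intro CollectI exI)
    next
      fix Z assume "Z \<in> {Z. \<exists>x1 x2 x3 x4 x5 x6 x7 x8 x9. Z = R.rep (emb x1) (emb x2) (emb x3) (emb
        x4) (emb x5) (emb x6) (emb x7) (emb x8) (emb x9)}"
      then show "Z \<in> range \<phi>"
        unfolding H_def[symmetric] h_comb[symmetric] by (elim CollectE exE) (simp only: rangeI)
    qed
  qed
  then show ?thesis
    unfolding algebra_isomorphic_def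
    by (intro exI[of _ \<phi>] conjI ballI allI h_add h_scale h_mult)
qed

lemma (in munn) rep_UNIV:
  assumes "p \<noteq> \<alpha> * \<beta> * k" "gram_det \<noteq> 0"
  shows "{Z. \<exists>x1 x2 x3 x4 x5 x6 x7 x8 x9. Z = rep x1 x2 x3 x4 x5 x6 x7 x8 x9} = UNIV"
proof -
  have "Z \<in> {Z. \<exists>x1 x2 x3 x4 x5 x6 x7 x8 x9. Z = rep x1 x2 x3 x4 x5 x6 x7 x8 x9}" for Z
  proof -
    have "Z = (Z ** gram_inv) ** gram"
      by (simp add: gram_inv_mult[OF assms(2)] flip: matrix_mul_assoc)
    from trans[OF this arg_cong[OF coeffs_surj[OF assms(1), of "Z ** gram_inv", symmetric],
        of "\<lambda>N. N ** gram"], folded rep_def]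
    show ?thesis by (intro CollectI exI)
  qed
  then show ?thesis by blast
qed

sublocale quadratic_extension \<subseteq> field_involution "adjoin emb z" "conj_ext emb z"
proof
  have sub: "is_subfield (adjoin emb z)"
    unfolding adjoin_def is_subfield_def by blast
  then show "0 \<in> adjoin emb z" "1 \<in> adjoin emb z"
    "\<And>x y. x \<in> adjoin emb z \<Longrightarrow> y \<in> adjoin emb z \<Longrightarrow> x - y \<in> adjoin emb z"
    "\<And>x y. x \<in> adjoin emb z \<Longrightarrow> y \<in> adjoin emb z \<Longrightarrow> x * y \<in> adjoin emb z"
    "\<And>x. x \<in> adjoin emb z \<Longrightarrow> inverse x \<in> adjoin emb z"
    unfolding is_subfield_def by simp_all
  \<comment> \<open>Conjugation rewritten with a plus sign, so that it can be applied again and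
    membership in \<open>adjoin\<close> can be read off.\<close>
  have conj': "conj_ext emb z (emb x + z * emb y) = emb x + z * emb (- y)" for x y
    by (simp add: conj_ext_eq emb_minus)
  fix q assume "q \<in> adjoin emb z"
  then obtain x y where q: "q = emb x + z * emb y" by (rule adjoinE)
  show "conj_ext emb z q \<in> adjoin emb z" unfolding q conj' adjoin_eq by blast
  show "conj_ext emb z (conj_ext emb z q) = q" unfolding q conj' by simp
  fix r assume "r \<in> adjoin emb z"
  then obtain x' y' where r: "r = emb x' + z * emb y'" by (rule adjoinE)
  have "q + r = emb (x + x') + z * emb (y + y')"
    by (simp add: q r emb_simps algebra_simps)
  then show "conj_ext emb z (q + r) = conj_ext emb z q + conj_ext emb z r"
    by (simp only: conj_ext_eq q r) (simp add: emb_simps algebra_simps)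
  have "q * r = emb (x * x' + d * (y * y')) + z * emb (x * y' + y * x')"
    by (simp add: q r emb_simps algebra_simps zz)
  then show "conj_ext emb z (q * r) = conj_ext emb z q * conj_ext emb z r"
    by (simp only: conj_ext_eq q r) (simp add: emb_simps algebra_simps zz)
qed

context quadratic_extension
begin

lemma emb_mem: "emb x \<in> adjoin emb z"
  and z_mem: "z \<in> adjoin emb z"
  unfolding adjoin_def by auto

lemma conj_emb: "conj_ext emb z (emb x) = emb x"
  using conj_ext_eq[of x 0] by (simp add: emb_0)

lemma conj_fixed:
  assumes "(2::'f) \<noteq> 0" "q \<in> adjoin emb z" "conj_ext emb z q = q"
  obtains x where "q = emb x"
proof -
  obtain x y where q: "q = emb x + z * emb y" using assms(2) by (rule adjoinE)
  have "emb x + z * emb (- y) = emb x + z * emb y"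
    using assms(3) by (simp add: q conj_ext_eq emb_minus)
  then have "- y = y" unfolding eq_iff by blast
  then have "2 * y = 0" by (simp only: neg_eq_iff_add_eq_0 mult_2)
  then have "y = 0" using assms(1) by simp
  then show ?thesis using that[of x] by (simp add: q emb_0)
qed

end

lemma (in axis_triple_psi) isomorphic_hermitian:
  fixes emb :: "'f \<Rightarrow> 'k::field" and z :: 'k and \<psi> :: 'f
  assumes gen: "generated_by {a, b, c}" and dim: "dim (UNIV :: 'a set) = 9"
    and s: "s = 2 * \<psi>" and det: "\<alpha> + \<beta> + \<gamma> - s - 1 \<noteq> 0"
    and not_square: "\<not> (\<exists>r. \<psi>\<^sup>2 - \<alpha> * \<beta> * \<gamma> = r\<^sup>2)"
    and emb: "field_embedding emb" and z: "z\<^sup>2 = emb (\<psi>\<^sup>2 - \<alpha> * \<beta> * \<gamma>)"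
  obtains T :: "'k^3^3" where "T \<in> matrices_over (adjoin emb z)" "invertible T"
    "twisted_conj_transpose emb z T T = T"
    "is_involution (matrices_over (adjoin emb z)) (\<lambda>r. mat_smult (emb r)) (**)
       (twisted_conj_transpose emb z T)"
    "algebra_isomorphic UNIV scale mult
       (hermitian_elements (matrices_over (adjoin emb z)) (twisted_conj_transpose emb z T))
       (\<lambda>r. mat_smult (emb r)) jordan_product"
proof -
  interpret Z: quadratic_extension emb z "\<psi>\<^sup>2 - \<alpha> * \<beta> * \<gamma>"
    by unfold_locales (fact emb z not_square)+
  let ?P = "adjoin emb z" and ?c = "conj_ext emb z"
  \<comment> \<open>The elements \<open>p\<close> and \<open>q\<close> are the roots of
    \<open>X\<^sup>2 - 2 \<psi> X + \<alpha> \<beta> \<gamma>\<close>, nonzero because 1 and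
    \<open>z\<close> are independent. The choice of \<open>k\<close> yields
    \<open>p * k = emb \<gamma>\<close> and makes the second root equal to
    \<open>emb \<alpha> * emb \<beta> * k\<close>.\<close>
  define p where "p = emb \<psi> + z"
  define q where "q = emb \<psi> - z"
  define k where "k = emb \<gamma> / p"
  have p0: "p \<noteq> 0" using Z.eq_0_iff[of \<psi> 1] by (simp add: p_def Z.emb_1)
  have q0: "q \<noteq> 0" using Z.eq_0_iff[of \<psi> "- 1"] by (simp add: q_def Z.emb_1 Z.emb_minus)
  have pq: "p * q = emb \<alpha> * emb \<beta> * emb \<gamma>"
    using z by (simp add: p_def q_def Z.emb_simps power2_eq_square algebra_simps)
  have q: "q = emb \<alpha> * emb \<beta> * k" using pq p0 by (simp add: k_def field_simps)
  have pk: "emb \<gamma> = p * k" using p0 by (simp add: k_def)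
  have es: "emb s = p + emb \<alpha> * emb \<beta> * k"
    unfolding q[symmetric] by (simp add: s Z.emb_simps p_def q_def)
  have two: "(2::'f) \<noteq> 0" by (rule A.two_neq_0)
  have "z \<noteq> 0" using Z.z_notin[of 0] by (simp add: Z.emb_0)
  moreover have "(2::'k) \<noteq> 0" using two Z.emb_eq_0[of 2] by (simp add: Z.emb_2)
  ultimately have "2 * z \<noteq> 0" by simp
  moreover have "p - q = 2 * z" by (simp add: p_def q_def)
  ultimately have pneq: "p \<noteq> emb \<alpha> * emb \<beta> * k"
    unfolding q[symmetric] by auto
  have "munn.gram_det (emb \<alpha>) (emb \<beta>) p k = - emb (\<alpha> + \<beta> + \<gamma> - s - 1)"
    unfolding munn.gram_det_def Z.emb_simps es pk by (simp add: algebra_simps)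
  then have det': "munn.gram_det (emb \<alpha>) (emb \<beta>) p k \<noteq> 0"
    using det Z.emb_eq_0 by simp
  \<comment> \<open>Otherwise the discriminant would be the square of \<psi>.\<close>
  have "\<alpha> \<noteq> 0" "\<beta> \<noteq> 0" using not_square by auto
  have cp: "?c p = q" using Z.conj_ext_eq[of \<psi> 1] by (simp add: p_def q_def Z.emb_1)
  have p_mem: "p \<in> ?P" unfolding p_def by (intro Z.mem Z.emb_mem Z.z_mem)
  have k_mem: "k \<in> ?P" unfolding k_def by (intro Z.mem Z.emb_mem p_mem)
  \<comment> \<open>Conjugating \<open>p * k = emb \<gamma>\<close> determines the conjugate of
    \<open>k\<close>, and comparison with \<open>p * q\<close> gives the required relation.\<close>
  have "?c (p * k) = q * ?c k" by (simp add: Z.c_mult p_mem k_mem cp)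
  then have "q * ?c k = emb \<gamma>" by (simp add: Z.conj_emb flip: pk)
  then have "q * (emb \<alpha> * emb \<beta> * ?c k) = q * p"
    using pq by (simp add: mult_ac)
  then have ck: "emb \<alpha> * emb \<beta> * ?c k = p" using q0 by simp
  interpret R: hermitian_munn "emb \<alpha>" "emb \<beta>" p k ?P ?c
    by unfold_locales
      (use Z.emb_mem p_mem k_mem Z.conj_emb Z.emb_eq_0 \<open>\<alpha> \<noteq> 0\<close> \<open>\<beta> \<noteq> 0\<close> cp q ck pneq det' in auto)
  have j: "twisted_conj_transpose emb z R.T = R.j"
    unfolding twisted_conj_transpose_def R.j_def R.matrix_inv_T Z.ct_def by (rule refl)
  \<comment> \<open>By \<open>j_rep\<close> and injectivity a matrix is fixed exactly when each
    coefficient is fixed by conjugation, that is, lies in the base field.\<close>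
  have "hermitian_elements (matrices_over ?P) R.j = {Z. \<exists>x1 x2 x3 x4 x5 x6 x7 x8 x9. Z = R.rep
    (emb x1) (emb x2) (emb x3) (emb x4) (emb x5) (emb x6) (emb x7) (emb x8) (emb x9)}"
  proof (intro equalityI subsetI)
    fix Y assume "Y \<in> hermitian_elements (matrices_over ?P) R.j"
    then have Y: "Y \<in> matrices_over ?P" "R.j Y = Y" by (simp_all add: hermitian_elements_def)
    obtain x1 x2 x3 x4 x5 x6 x7 x8 x9 where x: "{x1, x2, x3, x4, x5, x6, x7, x8, x9} \<subseteq> ?P" and Yx:
      "Y = R.rep x1 x2 x3 x4 x5 x6 x7 x8 x9"
      using Y(1) by (rule R.rep_surj)
    have fixed: "R.rep (?c x1) (?c x2) (?c x3) (?c x4) (?c x5) (?c x6) (?c x7) (?c x8) (?c x9) =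
      R.rep x1 x2 x3 x4 x5 x6 x7 x8 x9"
      using Y(2) unfolding Yx R.j_rep[OF x] .
    have *: "\<exists>y. x = emb y" if "x \<in> ?P" "?c x = x" for x
      by (rule Z.conj_fixed[OF two that]) blast
    have "(\<exists>y. x1 = emb y) \<and> (\<exists>y. x2 = emb y) \<and> (\<exists>y. x3 = emb y) \<and> (\<exists>y. x4 = emb y) \<and> (\<exists>y. x5 =
      emb y) \<and> (\<exists>y. x6 = emb y) \<and> (\<exists>y. x7 = emb y) \<and> (\<exists>y. x8 = emb y) \<and> (\<exists>y. x9 = emb y)"
      using R.rep_inject[OF R.p_neq R.det_neq_0 fixed] x
      by (intro conjI; elim conjE; intro *; simp only: insert_subset)
    then show "Y \<in> {Z. \<exists>x1 x2 x3 x4 x5 x6 x7 x8 x9. Z = R.rep (emb x1) (emb x2) (emb x3) (emb x4)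
      (emb x5) (emb x6) (emb x7) (emb x8) (emb x9)}"
      unfolding Yx by (elim conjE exE) (simp only: mem_Collect_eq, intro exI, rule refl)
  next
    fix Y assume "Y \<in> {Z. \<exists>x1 x2 x3 x4 x5 x6 x7 x8 x9. Z = R.rep (emb x1) (emb x2) (emb x3) (emb
      x4) (emb x5) (emb x6) (emb x7) (emb x8) (emb x9)}"
    then obtain x1 x2 x3 x4 x5 x6 x7 x8 x9 where Y: "Y = R.rep (emb x1) (emb x2) (emb x3) (emb x4)
      (emb x5) (emb x6) (emb x7) (emb x8) (emb x9)" by blast
    have x: "{emb x1, emb x2, emb x3, emb x4, emb x5, emb x6, emb x7, emb x8, emb x9} \<subseteq> ?P" by
      (intro insert_subsetI empty_subsetI Z.emb_mem)
    have "Y \<in> matrices_over ?P"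
      unfolding Y R.rep_def
      by (intro Z.mult_matrices_over R.coeffs_matrices_over x R.gram_matrices_over)
    moreover have "R.j Y = Y" unfolding Y R.j_rep[OF x] Z.conj_emb ..
    ultimately show "Y \<in> hermitian_elements (matrices_over ?P) R.j"
      by (simp add: hermitian_elements_def)
  qed
  then have iso: "algebra_isomorphic UNIV scale mult (hermitian_elements (matrices_over ?P) R.j)
     (\<lambda>r. mat_smult (emb r)) jordan_product"
    using algebra_isomorphic_rep[OF gen dim emb pk es pneq det'] by (simp only:)
  have invol: "is_involution (matrices_over ?P) (\<lambda>r. mat_smult (emb r)) (**) R.j"
    by (rule R.is_involution_j) (simp_all add: Z.emb_mem Z.conj_emb)
  show ?thesis
    by (rule that[of R.T, unfolded j, OF R.T_matrices_over R.invertible_T R.j_T invol iso])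
qed

lemma (in axis_triple_psi) isomorphic_full:
  fixes \<psi> r :: 'f
  assumes gen: "generated_by {a, b, c}" and dim: "dim (UNIV :: 'a set) = 9"
    and s: "s = 2 * \<psi>" and det: "\<alpha> + \<beta> + \<gamma> - s - 1 \<noteq> 0"
    and square: "\<psi>\<^sup>2 - \<alpha> * \<beta> * \<gamma> = r\<^sup>2" and "r \<noteq> 0"
  shows "algebra_isomorphic UNIV scale mult (UNIV :: ('f^3^3) set) mat_smult jordan_product"
proof -
  \<comment> \<open>The sign of the root is chosen so that \<open>p = \<psi> + r'\<close> is nonzero
    and can divide \<gamma>; if \<open>\<psi> + r = 0\<close>, then
    \<open>\<psi> - r = - 2 r\<close> is nonzero.\<close>
  obtain r' where r': "\<psi>\<^sup>2 - \<alpha> * \<beta> * \<gamma> = r'\<^sup>2" "r' \<noteq> 0" "\<psi> + r' \<noteq> 0"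
  proof (cases "\<psi> + r = 0")
    case True
    then have "\<psi> = - r" by (simp add: eq_neg_iff_add_eq_0)
    then have "\<psi> + - r = 2 * (- r)" by (simp only: mult_2)
    moreover have "2 * (- r) \<noteq> 0"
      using A.two_neq_0 \<open>r \<noteq> 0\<close> by (simp only: mult_eq_0_iff neg_equal_0_iff_equal simp_thms)
    ultimately have "\<psi> + - r \<noteq> 0" by (simp only: simp_thms)
    then show ?thesis using that[of "- r"] square \<open>r \<noteq> 0\<close> by simp
  qed (use that[of r] square \<open>r \<noteq> 0\<close> in blast)
  define p where "p = \<psi> + r'"
  define k where "k = \<gamma> / p"
  have p0: "p \<noteq> 0" using r'(3) by (simp add: p_def)
  have pk: "\<gamma> = p * k" using p0 by (simp add: k_def)
  have "p * (\<psi> - r') = \<alpha> * \<beta> * \<gamma>"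
    using r'(1) by (simp add: p_def power2_eq_square algebra_simps)
  then have "p * (\<alpha> * \<beta> * k) = p * (\<psi> - r')"
    unfolding pk by (auto simp: mult_ac)
  then have q: "\<alpha> * \<beta> * k = \<psi> - r'" using p0 by simp
  have es: "s = p + \<alpha> * \<beta> * k" unfolding q by (simp add: s p_def)
  have "2 * r' \<noteq> 0" using A.two_neq_0 r'(2) by simp
  moreover have "p - (\<psi> - r') = 2 * r'" by (simp add: p_def)
  ultimately have pneq: "p \<noteq> \<alpha> * \<beta> * k" unfolding q by auto
  have "munn.gram_det \<alpha> \<beta> p k = - (\<alpha> + \<beta> + \<gamma> - s - 1)"
    unfolding munn.gram_det_def es pk by (simp add: algebra_simps)
  then have det': "munn.gram_det \<alpha> \<beta> p k \<noteq> 0" using det by simp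
  \<comment> \<open>Both roots lie in the base field, so the identity serves as embedding and
    \<open>rep\<close> reaches all matrices.\<close>
  have "field_embedding (\<lambda>x::'f. x)" by (simp add: field_embedding_def)
  from algebra_isomorphic_rep[OF gen dim this pk es pneq det'] show ?thesis
    unfolding munn.rep_UNIV[OF pneq det'] .
qed

theorem theorem2:
  fixes scale :: "'f::field \<Rightarrow> 'a::ab_group_add \<Rightarrow> 'a"
    and mult :: "'a \<Rightarrow> 'a \<Rightarrow> 'a"
    and a b c :: 'a
    and \<alpha> \<beta> \<gamma> \<psi> :: 'f
  assumes "CHAR('f) \<noteq> 2"
    and "comm_nonassoc_algebra scale mult"
    and "comm_nonassoc_algebra.jordan_type_half_generated_by scale mult {a, b, c}"
    and "\<forall>x\<in>{a, b, c}. comm_nonassoc_algebra.primitive scale mult x"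
    and "\<alpha> = comm_nonassoc_algebra.phi scale mult a b"
    and "\<beta> = comm_nonassoc_algebra.phi scale mult b c"
    and "\<gamma> = comm_nonassoc_algebra.phi scale mult c a"
    and "\<psi> = comm_nonassoc_algebra.phi scale mult a (mult b c)"
    and "vector_space.dim scale (UNIV :: 'a set) = 9"
  shows
    "((\<alpha> + \<beta> + \<gamma> - 2 * \<psi> - 1) * (\<alpha> * \<beta> * \<gamma> - \<psi>\<^sup>2) \<noteq> 0 \<and>
      (\<exists>s::'f. \<psi>\<^sup>2 - \<alpha> * \<beta> * \<gamma> = s\<^sup>2) \<longrightarrow>
        algebra_isomorphic UNIV scale mult (UNIV :: ('f^3^3) set) mat_smult jordan_product)
     \<and>
     ((\<alpha> + \<beta> + \<gamma> - 2 * \<psi> - 1) * (\<alpha> * \<beta> * \<gamma> - \<psi>\<^sup>2) \<noteq> 0 \<and>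
      \<not> (\<exists>s::'f. \<psi>\<^sup>2 - \<alpha> * \<beta> * \<gamma> = s\<^sup>2) \<longrightarrow>
        (\<forall>(emb :: 'f \<Rightarrow> 'k::field) z.
           field_embedding emb \<and> z\<^sup>2 = emb (\<psi>\<^sup>2 - \<alpha> * \<beta> * \<gamma>) \<longrightarrow>
           (let P = adjoin emb z;
                M = (matrices_over P :: ('k^3^3) set);
                sm = (\<lambda>k::'f. mat_smult (emb k))
            in \<exists>T\<in>M. \<exists>t\<in>P.
                 let j = twisted_conj_transpose emb z T
                 in invertible T \<and>
                    j T = mat_smult t T \<and> t * conj_ext emb z t = 1 \<and>
                    is_involution M sm (**) j \<and>
                    algebra_isomorphic UNIV scale mult
                      (hermitian_elements M j) sm jordan_product)))
     \<and>
     ((\<alpha> + \<beta> + \<gamma> - 2 * \<psi> - 1) * (\<alpha> * \<beta> * \<gamma> - \<psi>\<^sup>2) = 0 \<longrightarrow>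
        \<not> comm_nonassoc_algebra.simple_algebra scale mult)"
proof -
  interpret comm_nonassoc_algebra scale mult by fact
  have "of_nat 2 \<noteq> (0::'f)"
  proof
    assume "of_nat 2 = (0::'f)"
    \<comment> \<open>The characteristic would divide the prime 2, and it is not 1 because
      \<open>1 \<noteq> 0\<close> in a field.\<close>
    then have "CHAR('f) dvd 2" by (simp only: of_nat_eq_0_iff_char_dvd)
    then have "CHAR('f) = 1 \<or> CHAR('f) = 2" using two_is_prime_nat prime_nat_iff by blast
    with assms(1) show False by simp
  qed
  then have two: "(2::'f) \<noteq> 0" by simp
  have axes: "half_axis scale mult x" if "x \<in> {a, b, c}" for x
    using assms(3,4) that two unfolding jordan_type_half_generated_by_def
    by (intro half_axis.intro half_axis_axioms.intro assms(2)) blast+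
  have gen: "generated_by {a, b, c}"
    using assms(3) unfolding jordan_type_half_generated_by_def by blast
  note dim = assms(9)
  interpret axis_triple scale mult a b c \<alpha> \<beta> \<gamma>
    by (intro axis_triple.intro axis_triple_axioms.intro assms(2) axes) (simp_all add: assms)
  \<comment> \<open>The parameter \<open>s\<close> is \<open>phi a\<close> of the doubled product
    \<open>f\<close>, hence twice \<psi>.\<close>
  interpret axis_triple_psi scale mult a b c \<alpha> \<beta> \<gamma> "2 * \<psi>"
    by unfold_locales (simp add: jp_def A.phi_scale assms(8))
  show ?thesis
  proof (intro conjI impI)
    assume *: "(\<alpha> + \<beta> + \<gamma> - 2 * \<psi> - 1) * (\<alpha> * \<beta> * \<gamma> - \<psi>\<^sup>2) \<noteq> 0 \<and>
      (\<exists>s::'f. \<psi>\<^sup>2 - \<alpha> * \<beta> * \<gamma> = s\<^sup>2)"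
    then obtain r where r: "\<psi>\<^sup>2 - \<alpha> * \<beta> * \<gamma> = r\<^sup>2" by blast
    with * have "r \<noteq> 0" by auto
    with * r show "algebra_isomorphic UNIV scale mult (UNIV :: ('f^3^3) set) mat_smult
      jordan_product"
      by (intro isomorphic_full[OF gen dim refl]) auto
  next
    assume *: "(\<alpha> + \<beta> + \<gamma> - 2 * \<psi> - 1) * (\<alpha> * \<beta> * \<gamma> - \<psi>\<^sup>2) \<noteq> 0 \<and>
      \<not> (\<exists>s::'f. \<psi>\<^sup>2 - \<alpha> * \<beta> * \<gamma> = s\<^sup>2)"
    show "\<forall>(emb :: 'f \<Rightarrow> 'k::field) z.
           field_embedding emb \<and> z\<^sup>2 = emb (\<psi>\<^sup>2 - \<alpha> * \<beta> * \<gamma>) \<longrightarrow>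
           (let P = adjoin emb z;
                M = (matrices_over P :: ('k^3^3) set);
                sm = (\<lambda>k::'f. mat_smult (emb k))
            in \<exists>T\<in>M. \<exists>t\<in>P.
                 let j = twisted_conj_transpose emb z T
                 in invertible T \<and>
                    j T = mat_smult t T \<and> t * conj_ext emb z t = 1 \<and>
                    is_involution M sm (**) j \<and>
                    algebra_isomorphic UNIV scale mult
                      (hermitian_elements M j) sm jordan_product)"
      unfolding Let_def
    proof (intro allI impI)
      fix emb :: "'f \<Rightarrow> 'k" and z
      assume e: "field_embedding emb \<and> z\<^sup>2 = emb (\<psi>\<^sup>2 - \<alpha> * \<beta> * \<gamma>)"
      interpret Z: quadratic_extension emb z "\<psi>\<^sup>2 - \<alpha> * \<beta> * \<gamma>"
        using e * by unfold_locales blast+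
      have one: "1 * conj_ext emb z 1 = 1" by (simp add: Z.c_1)
      have smult_one: "mat_smult 1 T = T" for T :: "'k^3^3"
        by (simp add: vec_eq_iff mat_smult_nth)
      have "\<alpha> + \<beta> + \<gamma> - 2 * \<psi> - 1 \<noteq> 0" using * by auto
      then obtain T :: "'k^3^3" where T: "T \<in> matrices_over (adjoin emb z)" "invertible T"
        "twisted_conj_transpose emb z T T = T"
        "is_involution (matrices_over (adjoin emb z)) (\<lambda>r. mat_smult (emb r)) (**)
           (twisted_conj_transpose emb z T)"
        "algebra_isomorphic UNIV scale mult
           (hermitian_elements (matrices_over (adjoin emb z)) (twisted_conj_transpose emb z T))
           (\<lambda>r. mat_smult (emb r)) jordan_product"
        using isomorphic_hermitian[OF gen dim refl] e * by metis
      show "\<exists>T\<in>matrices_over (adjoin emb z) :: ('k^3^3) set. \<exists>t\<in>adjoin emb z.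
          invertible T \<and> twisted_conj_transpose emb z T T = mat_smult t T \<and>
          t * conj_ext emb z t = 1 \<and>
          is_involution (matrices_over (adjoin emb z)) (\<lambda>k. mat_smult (emb k)) (**)
            (twisted_conj_transpose emb z T) \<and>
          algebra_isomorphic UNIV scale mult
            (hermitian_elements (matrices_over (adjoin emb z)) (twisted_conj_transpose emb z T))
            (\<lambda>k. mat_smult (emb k)) jordan_product"
        \<comment> \<open>The witness for \<open>t\<close> is 1.\<close>
        by (rule bexI[OF bexI[OF _ Z.one_mem] T(1)]) (intro conjI T one, simp only: smult_one T(3))
    qed
  next
    assume "(\<alpha> + \<beta> + \<gamma> - 2 * \<psi> - 1) * (\<alpha> * \<beta> * \<gamma> - \<psi>\<^sup>2) = 0"
    \<comment> \<open>If the first factor vanishes, the Gram determinant is zero; if the second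
      does, the discriminant of the quadratic with coefficient \<open>s = 2 * \<psi>\<close> is
      zero.\<close>
    then have "\<alpha> + \<beta> + \<gamma> - 2 * \<psi> - 1 = 0 \<or> (2 * \<psi>)\<^sup>2 = 4 * \<alpha> * \<beta> * \<gamma>"
      by (auto simp: power_mult_distrib mult.assoc)
    then show "\<not> simple_algebra"
      using not_simple_if_det_0[OF gen dim] not_simple_if_disc_0[OF gen dim] by blast
  qed
qed

end
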